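(* Let $q$ be an odd prime power, $n=2t$ with $t\geq 5$, let $\sigma$ be a generator of $\mathrm{Gal}(\mathbb{F}_{q^n}/\mathbb{F}_q)$, and let $h,k\in\mathbb{F}_{q^n}$ satisfy $\mathrm{N}_{q^n/q^t}(h)=\mathrm{N}_{q^n/q^t}(k)=-1$. Consider the codes $\mathcal{C}_{h,t,\sigma}$ and $\mathcal{C}_{k,t,\sigma^s}$. Then the following hold. I. If $s=1$, then $\mathcal{C}_{h,t,\sigma}$ and $\mathcal{C}_{k,t,\sigma^s}$ are equivalent if and only if there exists $\rho\in\mathrm{Aut}(\mathbb{F}_{q^n})$ such that: $\rho(h)\in\{k,-k\}$, if $t\not\equiv2\pmod 4$; $\rho(h)=lk$ for some $l\in\mathbb{F}_{q^n}$ with $l^{q^2+1}=1$, if $t\equiv2\pmod4$. II. If $s=-1$, then $\mathcal{C}_{h,t,\sigma}$ and $\mathcal{C}_{k,t,\sigma^s}$ are equivalent if and only if there exists $\rho\in\mathrm{Aut}(\mathbb{F}_{q^n})$ such that: $\rho(h)\in\{k^{-1},-k^{-1}\}$, if $t\not\equiv2\pmod 4$; $\rho(h)=lk^{-1}$ for some $l\in\mathbb{F}_{q^n}$ with $l^{q^2+1}=1$, if $t\equiv2\pmod4$. III. If $s=t-1$, with $t$ even, then $\mathcal{C}_{h,t,\sigma}$ and $\mathcal{C}_{k,t,\sigma^s}$ are equivalent if and only if there exists $\rho\in\mathrm{Aut}(\mathbb{F}_{q^n})$ such that: $\rho(h)\in\{k,-k\}$, if $t\not\equiv2\pmod 4$;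 $\rho(h)=lk$ for some $l\in\mathbb{F}_{q^n}$ with $l^{q^2+1}=1$, if $t\equiv2\pmod4$. IV. If $s=t+1$, with $t$ even, then $\mathcal{C}_{h,t,\sigma}$ and $\mathcal{C}_{k,t,\sigma^s}$ are equivalent if and only if there exists $\rho\in\mathrm{Aut}(\mathbb{F}_{q^n})$ such that: $\rho(h)\in\{k^{-1},-k^{-1}\}$, if $t\not\equiv2\pmod 4$; $\rho(h)=lk^{-1}$ for some $l\in\mathbb{F}_{q^n}$ with $l^{q^2+1}=1$, if $t\equiv2\pmod4$.
   Context: $\mathrm{N}_{q^n/q^t}(h)=h^{q^t+1}=h\,\sigma^t(h)$ is the norm from $\mathbb{F}_{q^n}$ to $\mathbb{F}_{q^t}$. For a generator $\sigma$ of $\mathrm{Gal}(\mathbb{F}_{q^n}/\mathbb{F}_q)$, $\mathcal{L}_{n,q}$ denotes the ring (under addition and composition) of $\sigma$-polynomials $f(x)=\sum_{i=0}^{n-1}f_ix^{\sigma^i}$, $f_i\in\mathbb{F}_{q^n}$, each identified with the $\mathbb{F}_q$-endomorphism $\alpha\mapsto\sum_i f_i\sigma^i(\alpha)$ of $\mathbb{F}_{q^n}$; thus $\mathcal{L}_{n,q}\cong\mathrm{End}_{\mathbb{F}_q}(\mathbb{F}_{q^n})$, independently of $\sigma$. $\langle\cdot\rangle_{\mathbb{F}_{q^n}}$ denotes the span with respect to left multiplication by scalars of $\mathbb{F}_{q^n}$. A rank-metric code is a subset of $\mathcal{L}_{n,q}$. Two rank-metric codes $\mathcal{C}_1,\mathcal{C}_2\subseteq\mathcal{L}_{n,q}$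 are equivalent if there exist invertible $f_1,f_2\in\mathcal{L}_{n,q}$ and a field automorphism $\rho\in\mathrm{Aut}(\mathbb{F}_{q^n})$ with $\mathcal{C}_1=\{f_1\circ g^{\rho}\circ f_2: g\in\mathcal{C}_2\}$, where $g^{\rho}(x)=\sum_i\rho(a_i)x^{\sigma^i}$ if $g(x)=\sum_i a_ix^{\sigma^i}$. For any generator $\tau$ of $\mathrm{Gal}(\mathbb{F}_{q^n}/\mathbb{F}_q)$ and any $h\in\mathbb{F}_{q^n}$ with $\mathrm{N}_{q^n/q^t}(h)=-1$, $\mathcal{C}_{h,t,\tau}=\langle x,\psi_{h,t,\tau}(x)\rangle_{\mathbb{F}_{q^n}}$, where $\psi_{h,t,\tau}(x)=x^{\tau}+x^{\tau^{t-1}}+h\tau(h)x^{\tau^{t+1}}+h\tau^{-1}(h^{-1})x^{\tau^{2t-1}}$. *)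

theory Defs
  imports "HOL-Number_Theory.Cong" "HOL-Number_Theory.Prime_Powers"
begin

text \<open>
  The field \<open>F\<^bsub>q^n\<^esub>\<close> is a type \<open>'a\<close> of class \<open>{field, finite}\<close> with \<open>q ^ n\<close> elements; its
  subfield \<open>F\<^bsub>q\<^esub>\<close> is then \<open>{x. x ^ q = x}\<close>. Field automorphisms are maps on \<open>'a\<close>, and the
  exponential notation \<open>x\<^sup>\<tau>\<close> is rendered as \<open>\<tau> x\<close>.
\<close>

definition field_aut :: "('a::field \<Rightarrow> 'a) \<Rightarrow> bool" where
  "field_aut \<rho> \<longleftrightarrow> bij \<rho> \<and> (\<forall>x y. \<rho> (x + y) = \<rho> x + \<rho> y) \<and> (\<forall>x y. \<rho> (x * y) = \<rho> x * \<rho> y)"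

definition galois_group :: "nat \<Rightarrow> ('a::field \<Rightarrow> 'a) set" where
  "galois_group q = {\<tau>. field_aut \<tau> \<and> (\<forall>x. x ^ q = x \<longrightarrow> \<tau> x = x)}"

definition int_funpow :: "('a \<Rightarrow> 'a) \<Rightarrow> int \<Rightarrow> 'a \<Rightarrow> 'a" where
  "int_funpow \<sigma> s = (if s \<ge> 0 then \<sigma> ^^ nat s else inv \<sigma> ^^ nat (- s))"

definition galois_generator :: "nat \<Rightarrow> ('a::field \<Rightarrow> 'a) \<Rightarrow> bool" where
  "galois_generator q \<sigma> \<longleftrightarrow> galois_group q = range (int_funpow \<sigma>)"

text \<open>The norm from \<open>F\<^bsub>q^n\<^esub>\<close> to \<open>F\<^bsub>q^t\<^esub>\<close> in the case \<open>n = 2 * t\<close>.\<close>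

definition rel_norm :: "nat \<Rightarrow> nat \<Rightarrow> 'a::field \<Rightarrow> 'a" where
  "rel_norm q t h = h ^ (q ^ t + 1)"

text \<open>
  The \<open>\<sigma>\<close>-polynomial with coefficients \<open>a 0, \<dots>, a (n - 1)\<close>, identified with the endomorphism
  it induces; the values of \<open>a\<close> beyond \<open>n - 1\<close> are irrelevant.
\<close>

definition sigma_poly :: "('a::field \<Rightarrow> 'a) \<Rightarrow> nat \<Rightarrow> (nat \<Rightarrow> 'a) \<Rightarrow> 'a \<Rightarrow> 'a" where
  "sigma_poly \<sigma> n a = (\<lambda>x. \<Sum>i<n. a i * (\<sigma> ^^ i) x)"

definition sigma_polys :: "('a::field \<Rightarrow> 'a) \<Rightarrow> nat \<Rightarrow> ('a \<Rightarrow> 'a) set" where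
  "sigma_polys \<sigma> n = range (sigma_poly \<sigma> n)"

definition invertible_sigma_poly :: "('a::field \<Rightarrow> 'a) \<Rightarrow> nat \<Rightarrow> ('a \<Rightarrow> 'a) \<Rightarrow> bool" where
  "invertible_sigma_poly \<sigma> n f \<longleftrightarrow>
     f \<in> sigma_polys \<sigma> n \<and> (\<exists>g \<in> sigma_polys \<sigma> n. f \<circ> g = id \<and> g \<circ> f = id)"

text \<open>
  The elements \<open>g\<close> of \<open>C2\<close> are enumerated through their coefficients \<open>a\<close>, which are uniquely
  determined below \<open>n\<close> when \<open>\<sigma>\<close> has order \<open>n\<close>; then \<open>sigma_poly \<sigma> n (\<rho> \<circ> a)\<close> is \<open>g\<^sup>\<rho>\<close>.
\<close>

definition code_equivalent ::
  "('a::field \<Rightarrow> 'a) \<Rightarrow> nat \<Rightarrow> ('a \<Rightarrow> 'a) set \<Rightarrow> ('a \<Rightarrow> 'a) set \<Rightarrow> bool" where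
  "code_equivalent \<sigma> n C1 C2 \<longleftrightarrow>
     C1 \<subseteq> sigma_polys \<sigma> n \<and> C2 \<subseteq> sigma_polys \<sigma> n \<and>
     (\<exists>f1 f2 \<rho>. invertible_sigma_poly \<sigma> n f1 \<and> invertible_sigma_poly \<sigma> n f2 \<and> field_aut \<rho> \<and>
        C1 = {f1 \<circ> sigma_poly \<sigma> n (\<rho> \<circ> a) \<circ> f2 | a. sigma_poly \<sigma> n a \<in> C2})"

definition psi :: "'a::field \<Rightarrow> nat \<Rightarrow> ('a \<Rightarrow> 'a) \<Rightarrow> 'a \<Rightarrow> 'a" where
  "psi h t \<tau> = (\<lambda>x. \<tau> x + (\<tau> ^^ (t - 1)) x + h * \<tau> h * (\<tau> ^^ (t + 1)) x
                   + h * inv \<tau> (inverse h) * (\<tau> ^^ (2 * t - 1)) x)"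

text \<open>The left span of the identity and \<open>psi h t \<tau>\<close> over \<open>F\<^bsub>q^n\<^esub>\<close>.\<close>

definition psi_code :: "'a::field \<Rightarrow> nat \<Rightarrow> ('a \<Rightarrow> 'a) \<Rightarrow> ('a \<Rightarrow> 'a) set" where
  "psi_code h t \<tau> = {\<lambda>x. a * x + b * psi h t \<tau> x | a b. True}"

end

(*
  Write X^i for sigma^i and let psi_h be the four-term polynomial with exponents 1, t-1, t+1, -1. Since
  psi_h o psi_h has coefficients 1 + h / sigma^2(h) at X^2 and 2 + 2 h^2 at X^t, which cannot both
  vanish, the left idealiser of the code C_h consists of the scalars. Hence an equivalence amounts to
  C_h = C_(rho k) o f for some field automorphism rho and some invertible f = a + b psi_h.
  Comparing coefficients for s = 1, the a-part and the b-part each force m sigma^2(m) = 1 for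
  m = rho(k) / h; together with m sigma^t(m) = 1 this gives m = 1 or m = -1 unless t = 2 mod 4.
  Conversely such an m is realised by a scalar f = a, found by Hilbert 90.
  The other values of s reduce to s = 1: C_h is a right multiple of the code of 1/h for sigma^(-1), and
  for even t of the code of h for sigma^(t-1). The multiplier is either a scalar or b psi_h, where
  the polynomial of the other code is, up to a constant, the inverse of b psi_h.
*)
theory Submission
  imports Defs "HOL-Computational_Algebra.Polynomial"
begin

section \<open>Automorphisms of finite fields\<close>

text \<open>The relation m \<sigma>^2(m) = 1 makes \<sigma>^4 fix m, which is why t modulo 4 shapes
  the answer. If 4 divides t, then \<sigma>^t fixes m; if t is odd, already \<sigma>^2 does; in both
  cases m^2 = 1. If t = 2 mod 4, then \<sigma>^t acts on m as \<sigma>^2, so the norm condition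
  repeats the relation and all its solutions survive. The bound t >= 5 keeps the exponents 0, t, 1,
  -1, t+1, t-1, 2, -2, t+2, t-2 distinct modulo 2t, so that coefficients can be compared at all; for
  t = 4 the exponents 2 and t-2 collide. The two coefficients of psi_h o psi_h cannot both vanish
  because that would mean \<sigma>^2(h) = -h and h^2 = -1. The second equation gives \<sigma>(h) = h
  or -h, hence \<sigma>^2(h) = h, and 2h = 0 contradicts odd q. A multiplier b psi_h works by
  exchanging the two generators of a code: it turns the identity into b psi_h and the inverse
  polynomial into a multiple of the identity.\<close>

lemma field_autD:
  fixes \<rho> :: "'a::field \<Rightarrow> 'a"
  assumes "field_aut \<rho>"
  shows "\<rho> (x + y) = \<rho> x + \<rho> y" "\<rho> (x * y) = \<rho> x * \<rho> y" "\<rho> 0 = 0" "\<rho> 1 = 1"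
    "\<rho> (- x) = - \<rho> x" "\<rho> (x - y) = \<rho> x - \<rho> y" "\<rho> (inverse x) = inverse (\<rho> x)"
    "\<rho> (x / y) = \<rho> x / \<rho> y" "\<rho> x = \<rho> y \<longleftrightarrow> x = y" "\<rho> x = 0 \<longleftrightarrow> x = 0"
    "\<rho> (x ^ m) = \<rho> x ^ m" "\<rho> (of_nat m) = of_nat m"
proof -
  have add: "\<rho> (x + y) = \<rho> x + \<rho> y" and mult: "\<rho> (x * y) = \<rho> x * \<rho> y" for x y
    using assms by (auto simp: field_aut_def)
  have inj: "\<rho> x = \<rho> y \<longleftrightarrow> x = y" for x y
    using assms by (auto simp: field_aut_def bij_def dest: injD)
  have zero: "\<rho> 0 = 0"
    using add[of 0 0] by (metis add.right_neutral add_left_cancel)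
  have eq0: "\<rho> x = 0 \<longleftrightarrow> x = 0" for x
    using inj[of x 0] zero by simp
  have one: "\<rho> 1 = 1"
    using mult[of 1 1] eq0[of 1] by simp
  have neg: "\<rho> (- x) = - \<rho> x" for x
    using add[of x "- x"] zero by (simp add: eq_neg_iff_add_eq_0 add.commute)
  have inverse: "\<rho> (inverse x) = inverse (\<rho> x)" for x
  proof (cases "x = 0")
    case False
    then have "\<rho> (inverse x) * \<rho> x = 1"
      using one by (simp flip: mult)
    then show ?thesis
      by (metis inverse_unique mult.commute)
  qed (simp add: zero)
  show "\<rho> (x + y) = \<rho> x + \<rho> y" "\<rho> (x * y) = \<rho> x * \<rho> y" "\<rho> 0 = 0" "\<rho> 1 = 1"
    "\<rho> (- x) = - \<rho> x" "\<rho> (inverse x) = inverse (\<rho> x)" "\<rho> x = \<rho> y \<longleftrightarrow> x = y" "\<rho> x = 0 \<longleftrightarrow> x = 0"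
    by (fact add mult zero one neg inverse inj eq0)+
  show "\<rho> (x - y) = \<rho> x - \<rho> y"
    using add[of x "- y"] neg by simp
  show "\<rho> (x / y) = \<rho> x / \<rho> y"
    by (simp add: divide_inverse mult inverse)
  show "\<rho> (x ^ m) = \<rho> x ^ m"
    by (induction m) (simp_all add: one mult)
  show "\<rho> (of_nat m) = of_nat m"
    by (induction m) (simp_all add: zero one add)
qed

lemma field_aut_sum:
  assumes "field_aut \<rho>"
  shows "\<rho> (sum f A) = (\<Sum>x\<in>A. \<rho> (f x))"
  by (induction A rule: infinite_finite_induct) (simp_all add: field_autD[OF assms])

lemma field_aut_bij: "field_aut \<rho> \<Longrightarrow> bij \<rho>"
  by (simp add: field_aut_def)

lemma field_aut_id: "field_aut id"
  by (simp add: field_aut_def)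

lemma field_aut_comp: "field_aut \<rho> \<Longrightarrow> field_aut \<theta> \<Longrightarrow> field_aut (\<rho> \<circ> \<theta>)"
  by (auto simp: field_aut_def intro: bij_comp)

lemma field_aut_inv:
  assumes "field_aut \<rho>"
  shows "field_aut (inv \<rho>)"
proof -
  have b: "bij \<rho>" by (rule field_aut_bij[OF assms])
  have "inv \<rho> (x + y) = inv \<rho> x + inv \<rho> y" "inv \<rho> (x * y) = inv \<rho> x * inv \<rho> y" for x y
    by (rule inv_f_eq[OF bij_is_inj[OF b]],
        simp add: field_autD[OF assms] surj_f_inv_f[OF bij_is_surj[OF b]])+
  then show ?thesis
    using b by (simp add: field_aut_def bij_imp_bij_inv)
qed

lemma field_aut_funpow: "field_aut \<rho> \<Longrightarrow> field_aut (\<rho> ^^ m)"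
  by (induction m) (auto simp: field_aut_id[unfolded id_def] field_aut_comp id_def field_aut_id)

text \<open>Dedekind's independence of characters: if \<open>f\<close> is one of the automorphisms and \<open>y\<close> separates
  it from another one \<open>g\<close>, then subtracting \<open>f y\<close> times the relation at \<open>x\<close> from the relation
  at \<open>y * x\<close> kills \<open>f\<close> and keeps \<open>g\<close>.\<close>

lemma field_aut_independent:
  fixes A :: "('a::field \<Rightarrow> 'a) set"
  assumes "finite A" "\<And>f. f \<in> A \<Longrightarrow> field_aut f" "\<And>x. (\<Sum>f\<in>A. c f * f x) = 0" "g \<in> A"
  shows "c g = 0"
  using assms
proof (induction A arbitrary: c g rule: finite_induct)
  case (insert f A)
  note aut = insert.prems(1)
  have rel: "c f * f x + (\<Sum>g\<in>A. c g * g x) = 0" for x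
    using insert.prems(2)[of x] insert.hyps by simp
  have A: "c g = 0" if "g \<in> A" for g
  proof -
    have "f \<noteq> g" using that insert.hyps(2) by auto
    then obtain y where y: "f y \<noteq> g y" by (auto simp: fun_eq_iff)
    have "(\<Sum>g\<in>A. (c g * (g y - f y)) * g x) = 0" for x
    proof -
      have "c f * f (y * x) + (\<Sum>g\<in>A. c g * g (y * x)) - f y * (c f * f x + (\<Sum>g\<in>A. c g * g x)) = 0"
        using rel by simp
      moreover have "(\<Sum>g\<in>A. c g * g (y * x)) = (\<Sum>g\<in>A. c g * g y * g x)"
        by (intro sum.cong refl) (simp add: field_autD(2)[OF aut])
      ultimately show ?thesis
        using field_autD(2)[OF aut, of f y x]
        by (simp add: algebra_simps sum_subtractf sum_distrib_left)
    qed
    then have "c g * (g y - f y) = 0"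
      using insert.IH[of "\<lambda>g. c g * (g y - f y)" g] aut that by auto
    then show ?thesis using y by simp
  qed
  moreover have "c f = 0"
    using rel[of 1] A field_autD(4)[OF aut, of f] by simp
  ultimately show ?case using insert.prems(3) by auto
qed simp

section \<open>Frobenius map and Galois group of a finite field\<close>

lemma card_power_fixed_le:
  fixes S :: "'a::{field,finite} set"
  assumes "m > 1" "\<And>x. x \<in> S \<Longrightarrow> x ^ m = x"
  shows "card S \<le> m"
proof -
  let ?P = "monom (1::'a) m - monom 1 1"
  have c: "coeff ?P m = 1" using assms(1) by simp
  have nz: "?P \<noteq> 0"
  proof
    assume "?P = 0"
    then show False using c by (metis coeff_0 zero_neq_one)
  qed
  have deg: "degree ?P \<le> m"
    by (rule order_trans[OF degree_diff_le_max]) (use assms(1) in \<open>auto simp: degree_monom_eq\<close>)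
  have "S \<subseteq> {x. poly ?P x = 0}"
    using assms(2) by (auto simp: poly_monom)
  then have "card S \<le> card {x. poly ?P x = 0}"
    by (intro card_mono) auto
  also have "\<dots> \<le> degree ?P"
    using nz by (rule card_poly_roots_bound)
  finally show ?thesis using deg by simp
qed

locale finite_field_ext =
  fixes q n :: nat and ty :: "'a::{field,finite} itself"
  assumes q: "primepow q" and card: "card (UNIV :: 'a set) = q ^ n"
begin

definition \<phi> :: "'a \<Rightarrow> 'a" where "\<phi> x = x ^ q"

lemma n_pos: "n > 0"
proof (rule ccontr)
  assume "\<not> n > 0"
  then have "card (UNIV :: 'a set) = 1" using card by simp
  then have "card {0, 1 :: 'a} \<le> 1" by (metis card_mono finite_UNIV subset_UNIV finite)
  then show False by simp
qed

lemma q_gt_1: "q > 1"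
  using q by (rule primepow_gt_Suc_0[unfolded One_nat_def[symmetric]])

text \<open>Translation by 1 permutes the field, so summing all elements in two ways shows that the
  number of elements is 0 in the field.\<close>

lemma CHAR_dvd: "CHAR('a) dvd q ^ n"
proof -
  have "(\<Sum>x\<in>UNIV. x + 1 :: 'a) = \<Sum>UNIV"
    by (rule sum.reindex_bij_betw) (rule bij_betwI[of _ _ _ "\<lambda>x. x - 1"], auto)
  then have "of_nat (card (UNIV :: 'a set)) = (0 :: 'a)"
    by (simp add: sum.distrib)
  then show ?thesis by (simp add: card of_nat_eq_0_iff_char_dvd del: of_nat_power)
qed

lemma prime_CHAR: "prime CHAR('a)"
  by (intro prime_CHAR_semidom finite_imp_CHAR_pos) simp

lemma q_power_CHAR: "\<exists>e>0. q = CHAR('a) ^ e"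
proof -
  obtain p e where pe: "prime p" "e > 0" "q = p ^ e"
    using q by (auto simp: primepow_def)
  have "CHAR('a) dvd p"
    using CHAR_dvd prime_CHAR pe(3) by (metis prime_dvd_power)
  then have "CHAR('a) = p"
    using prime_CHAR pe(1) by (simp add: primes_dvd_imp_eq)
  then show ?thesis using pe by auto
qed

lemma field_aut_\<phi>: "field_aut \<phi>"
proof -
  obtain e where e: "q = CHAR('a) ^ e" using q_power_CHAR by auto
  have add: "\<phi> (x + y) = \<phi> x + \<phi> y" for x y
    unfolding \<phi>_def using e freshmans_dream'[OF prime_CHAR, of q e x y] by simp
  have mult: "\<phi> (x * y) = \<phi> x * \<phi> y" for x y
    by (simp add: \<phi>_def power_mult_distrib)
  have "inj \<phi>"
  proof (rule injI)
    fix x y assume "\<phi> x = \<phi> y"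
    then have "\<phi> (x - y) = 0" using add[of "x - y" y] by simp
    then show "x = y" by (simp add: \<phi>_def)
  qed
  then show ?thesis
    using add mult by (simp add: field_aut_def bij_def finite_UNIV_inj_surj)
qed

lemma \<phi>_funpow: "(\<phi> ^^ i) x = x ^ (q ^ i)"
  by (induction i) (simp_all add: \<phi>_def mult.commute flip: power_mult)

text \<open>Multiplication by a nonzero x permutes the nonzero elements; comparing the two products
  gives \<open>x ^ (q ^ n - 1) = 1\<close>.\<close>

lemma \<phi>_order: "\<phi> ^^ n = id"
proof
  fix x :: 'a
  have "x ^ (q ^ n) = x"
  proof (cases "x = 0")
    case False
    have "bij_betw ((*) x) (UNIV - {0}) (UNIV - {0})"
      by (rule bij_betwI[of _ _ _ "\<lambda>y. y / x"]) (use False in auto)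
    then have "(\<Prod>y\<in>UNIV - {0}. x * y) = \<Prod>(UNIV - {0})"
      by (rule prod.reindex_bij_betw)
    then have "x ^ card (UNIV - {0 :: 'a}) = 1"
      by (simp add: prod.distrib)
    then have "x * x ^ (q ^ n - 1) = x"
      by (simp add: card card_Diff_singleton)
    moreover have "q ^ n > 0" using q_gt_1 by simp
    ultimately show ?thesis
      by (simp flip: power_Suc)
  qed (use q_gt_1 in simp)
  then show "(\<phi> ^^ n) x = id x" by (simp add: \<phi>_funpow)
qed

text \<open>Otherwise all \<open>q ^ n\<close> elements would be roots of a nonzero polynomial of
  degree \<open>q ^ i\<close>.\<close>

lemma \<phi>_funpow_id: "i < n \<Longrightarrow> \<phi> ^^ i = id \<Longrightarrow> i = 0"
proof (rule ccontr)
  assume i: "i < n" "\<phi> ^^ i = id" "i \<noteq> 0"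
  then have "x ^ (q ^ i) = x" for x :: 'a
    by (metis \<phi>_funpow id_apply)
  moreover have "q ^ i > 1"
    using i q_gt_1 by (metis one_less_power neq0_conv)
  ultimately have "card (UNIV :: 'a set) \<le> q ^ i"
    by (intro card_power_fixed_le) auto
  moreover have "q ^ i < q ^ n"
    using i(1) q_gt_1 by (rule power_strict_increasing)
  ultimately show False
    using card by linarith
qed

end

lemma inj_on_funpow_order:
  assumes inj: "inj \<sigma>" and id: "\<And>i. i < n \<Longrightarrow> \<sigma> ^^ i = id \<Longrightarrow> i = 0"
  shows "inj_on (\<lambda>i. \<sigma> ^^ i) {..<n}"
proof (rule linorder_inj_onI')
  fix i j assume ij: "i \<in> {..<n}" "j \<in> {..<n}" "i < j"
  show "\<sigma> ^^ i \<noteq> \<sigma> ^^ j"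
  proof
    assume eq: "\<sigma> ^^ i = \<sigma> ^^ j"
    have "\<sigma> ^^ (j - i) = id"
    proof
      fix x
      have "(\<sigma> ^^ i) ((\<sigma> ^^ (j - i)) x) = (\<sigma> ^^ i) x"
        using eq ij(3) by (metis comp_apply funpow_add le_add_diff_inverse less_imp_le)
      then show "(\<sigma> ^^ (j - i)) x = id x"
        using inj_fn[OF inj] by (simp add: inj_eq)
    qed
    then show False using id[of "j - i"] ij by (simp add: less_imp_diff_less)
  qed
qed

context finite_field_ext
begin

text \<open>If \<open>\<theta>\<close> were not a power of \<open>\<phi>\<close>, then the automorphisms \<open>\<theta> \<circ> \<phi>\<^sup>i\<close> and \<open>\<phi>\<^sup>i\<close> would satisfy a linear relation, since \<open>\<theta>\<close>
  fixes the values of the trace \<open>\<Sum>\<^sub>i \<phi>\<^sup>i\<close>.\<close>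

lemma galois_group_subset:
  assumes "\<theta> \<in> galois_group q"
  shows "\<exists>i<n. \<theta> = \<phi> ^^ i"
proof (rule ccontr)
  assume no: "\<not> (\<exists>i<n. \<theta> = \<phi> ^^ i)"
  have \<theta>: "field_aut \<theta>" and fix\<theta>: "\<And>x. x ^ q = x \<Longrightarrow> \<theta> x = x"
    using assms by (auto simp: galois_group_def)
  let ?A = "(\<lambda>i. \<phi> ^^ i) ` {..<n}" and ?B = "(\<lambda>i. \<theta> \<circ> \<phi> ^^ i) ` {..<n}"
  have inj: "inj_on (\<lambda>i. \<phi> ^^ i) {..<n}"
    by (intro inj_on_funpow_order \<phi>_funpow_id bij_is_inj field_aut_bij field_aut_\<phi>)
  have inj': "inj_on (\<lambda>i. \<theta> \<circ> \<phi> ^^ i) {..<n}"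
  proof (rule inj_onI)
    fix i j assume ij: "i \<in> {..<n}" "j \<in> {..<n}" "\<theta> \<circ> \<phi> ^^ i = \<theta> \<circ> \<phi> ^^ j"
    then have "\<phi> ^^ i = \<phi> ^^ j"
      using field_autD(9)[OF \<theta>] by (simp add: fun_eq_iff)
    then show "i = j" using inj ij by (auto dest: inj_onD)
  qed
  have disj: "?A \<inter> ?B = {}"
  proof (rule ccontr)
    assume "?A \<inter> ?B \<noteq> {}"
    then obtain i j where ij: "i < n" "j < n" "\<phi> ^^ i = \<theta> \<circ> \<phi> ^^ j" by auto
    let ?k = "(i + (n - j)) mod n"
    have "\<theta> x = (\<phi> ^^ (i + (n - j))) x" for x
    proof -
      have "(\<phi> ^^ j) ((\<phi> ^^ (n - j)) x) = x"
        using \<phi>_order ij(2) by (metis comp_apply funpow_add id_apply le_add_diff_inverse less_imp_le)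
      then show ?thesis
        using ij(3) by (metis comp_apply funpow_add)
    qed
    moreover have "(\<phi> ^^ (i + (n - j))) x = (\<phi> ^^ ?k) x" for x
      by (rule funpow_mod_eq[symmetric]) (simp add: \<phi>_order)
    ultimately have "\<theta> = \<phi> ^^ ?k" by auto
    moreover have "?k < n" using n_pos by simp
    ultimately show False using no by blast
  qed
  define T where "T x = (\<Sum>i<n. (\<phi> ^^ i) x)" for x
  have "\<phi> (T x) = T x" for x
  proof -
    have "\<phi> (T x) = (\<Sum>i<n. (\<phi> ^^ Suc i) x)"
      by (simp add: T_def field_aut_sum[OF field_aut_\<phi>])
    also have "\<dots> + (\<phi> ^^ 0) x = (\<Sum>i<Suc n. (\<phi> ^^ i) x)"
      by (subst sum.lessThan_Suc_shift) simp
    also have "\<dots> = T x + x"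
      by (simp add: T_def \<phi>_order)
    finally show ?thesis by simp
  qed
  then have fixT: "\<theta> (T x) = T x" for x
    using fix\<theta> by (simp add: \<phi>_def)
  \<comment> \<open>The sum over \<open>?A\<close> is the trace and the sum over \<open>?B\<close>
    is its image under \<theta>, which is the same value. The signs turn this equality into a
    nontrivial relation between distinct automorphisms.\<close>
  define c where "c f = (if f \<in> ?A then 1 else - 1 :: 'a)" for f
  have "(\<Sum>f\<in>?A \<union> ?B. c f * f x) = 0" for x
  proof -
    have "(\<Sum>f\<in>?A \<union> ?B. c f * f x) = (\<Sum>f\<in>?A. c f * f x) + (\<Sum>f\<in>?B. c f * f x)"
      using disj by (intro sum.union_disjoint) auto
    also have "(\<Sum>f\<in>?A. c f * f x) = (\<Sum>f\<in>?A. f x)"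
      by (intro sum.cong refl) (auto simp: c_def)
    also have "\<dots> = T x"
      by (simp add: sum.reindex[OF inj] T_def)
    also have "(\<Sum>f\<in>?B. c f * f x) = (\<Sum>f\<in>?B. - f x)"
      using disj by (intro sum.cong refl) (auto simp: c_def)
    also have "\<dots> = - \<theta> (T x)"
      by (simp add: sum.reindex[OF inj'] T_def field_aut_sum[OF \<theta>] sum_negf)
    finally show ?thesis by (simp only: fixT add.right_inverse)
  qed
  moreover have "field_aut f" if "f \<in> ?A \<union> ?B" for f
    using that \<theta> by (auto intro: field_aut_funpow field_aut_comp field_aut_\<phi>)
  moreover have "\<phi> ^^ 0 \<in> ?A" using n_pos by blast
  ultimately have "c (\<phi> ^^ 0) = 0"
    using field_aut_independent[of "?A \<union> ?B" c "\<phi> ^^ 0"] by blast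
  then show False using \<open>\<phi> ^^ 0 \<in> ?A\<close> by (simp add: c_def)
qed

lemma \<phi>_in_galois_group: "\<phi> \<in> galois_group q"
  using field_aut_\<phi> by (simp add: galois_group_def \<phi>_def)

text \<open>Over the prime field, every automorphism is a power of the Frobenius.\<close>

lemma field_aut_commute:
  fixes \<rho> \<theta> :: "'a \<Rightarrow> 'a"
  assumes "field_aut \<rho>" "field_aut \<theta>"
  shows "\<rho> (\<theta> x) = \<theta> (\<rho> x)"
proof -
  obtain e where e: "e > 0" "q = CHAR('a) ^ e" using q_power_CHAR by blast
  interpret P: finite_field_ext "CHAR('a)" "e * n" ty
    by unfold_locales (use prime_CHAR card e in \<open>simp_all add: power_mult\<close>)
  \<comment> \<open>\<open>?S\<close> is the prime field: the images of the natural numbers already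
    provide as many elements as a polynomial of degree \<open>CHAR('a)\<close> can have
    roots.\<close>
  let ?S = "{x :: 'a. x ^ CHAR('a) = x}"
  have sub: "of_nat ` {..<CHAR('a)} \<subseteq> ?S"
    by (auto simp: P.\<phi>_def[symmetric] field_autD[OF P.field_aut_\<phi>])
  have "inj_on (of_nat :: nat \<Rightarrow> 'a) {..<CHAR('a)}"
    by (auto simp: inj_on_def of_nat_eq_iff_cong_CHAR cong_def)
  then have "card (of_nat ` {..<CHAR('a)} :: 'a set) = CHAR('a)"
    by (simp add: card_image)
  moreover have "card ?S \<le> CHAR('a)"
    using P.q_gt_1 by (intro card_power_fixed_le) auto
  ultimately have S: "of_nat ` {..<CHAR('a)} = ?S"
    using sub by (intro card_seteq) auto
  have "\<exists>i. \<rho> = P.\<phi> ^^ i" if "field_aut \<rho>" for \<rho>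
  proof -
    have "\<rho> x = x" if "x ^ CHAR('a) = x" for x
    proof -
      from that S obtain m where "x = of_nat m" by blast
      then show ?thesis by (simp add: field_autD[OF \<open>field_aut \<rho>\<close>])
    qed
    with that have "\<rho> \<in> galois_group CHAR('a)" by (simp add: galois_group_def)
    then show ?thesis using P.galois_group_subset by blast
  qed
  then obtain i j where "\<rho> = P.\<phi> ^^ i" "\<theta> = P.\<phi> ^^ j" using assms by meson
  then show ?thesis by (metis add.commute comp_apply funpow_add)
qed

text \<open>The Frobenius map has order exactly \<open>n\<close> and is a power of \<sigma>, so
  \<open>n\<close> divides every exponent that kills \<sigma>. For \<sigma> = \<phi>^i the exponent
  \<open>n div gcd i n\<close> kills \<sigma>, which forces the gcd to be 1. Coprimality is used
  later to see that \<open>i\<close> is odd.\<close>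

lemma galois_generator_order:
  fixes \<sigma> :: "'a \<Rightarrow> 'a"
  assumes "galois_generator q \<sigma>"
  shows "field_aut \<sigma>" "\<sigma> ^^ n = id" "\<And>i. i < n \<Longrightarrow> \<sigma> ^^ i = id \<Longrightarrow> i = 0"
    "\<exists>j. \<phi> = \<sigma> ^^ j" "\<exists>i. coprime i n \<and> \<sigma> = \<phi> ^^ i"
proof -
  have "int_funpow \<sigma> 1 \<in> galois_group q"
    using assms by (simp add: galois_generator_def)
  then have \<sigma>: "\<sigma> \<in> galois_group q" by (simp add: int_funpow_def)
  then show aut: "field_aut \<sigma>" by (simp add: galois_group_def)
  obtain i where i: "\<sigma> = \<phi> ^^ i" using galois_group_subset[OF \<sigma>] by blast
  have "\<sigma> ^^ n = (\<phi> ^^ n) ^^ i" by (simp add: i funpow_mult mult.commute)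
  then show id: "\<sigma> ^^ n = id" by (simp add: \<phi>_order)
  \<comment> \<open>With the inverse a natural power, the integer exponents of
    \<open>int_funpow\<close> reduce to natural ones.\<close>
  have inv: "inv \<sigma> = \<sigma> ^^ (n - 1)"
  proof (rule inv_unique_comp)
    show "\<sigma> \<circ> \<sigma> ^^ (n - 1) = id" using id n_pos by (metis Suc_pred' funpow.simps(2))
    show "\<sigma> ^^ (n - 1) \<circ> \<sigma> = id" using id n_pos by (metis Suc_pred' funpow_Suc_right)
  qed
  obtain z where z: "\<phi> = int_funpow \<sigma> z"
    using assms \<phi>_in_galois_group by (auto simp: galois_generator_def)
  then show "\<exists>j. \<phi> = \<sigma> ^^ j"
    unfolding int_funpow_def inv by (auto simp: funpow_mult)
  then obtain j where j: "\<phi> = \<sigma> ^^ j" by blast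
  have dvd: "n dvd m" if "\<phi> ^^ m = id" for m
  proof -
    have "\<phi> ^^ (m mod n) = id"
    proof
      fix x
      show "(\<phi> ^^ (m mod n)) x = id x"
        using that funpow_mod_eq[of n \<phi> x m] \<phi>_order by simp
    qed
    then show ?thesis
      using \<phi>_funpow_id[of "m mod n"] n_pos by (simp add: mod_eq_0_iff_dvd)
  qed
  have dvd\<sigma>: "n dvd m" if "\<sigma> ^^ m = id" for m
  proof -
    have "\<phi> ^^ m = (\<sigma> ^^ m) ^^ j" by (simp add: j funpow_mult mult.commute)
    then show ?thesis using that dvd by simp
  qed
  show "m = 0" if "m < n" "\<sigma> ^^ m = id" for m
    using dvd\<sigma>[OF that(2)] that(1) by (auto dest: dvd_imp_le)
  let ?d = "gcd i n"
  have "\<sigma> ^^ (n div ?d) = \<phi> ^^ (i * (n div ?d))" by (simp add: i funpow_mult)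
  also have "i * (n div ?d) = n * (i div ?d)"
    by (simp add: div_mult_swap mult.commute)
  also have "\<phi> ^^ (n * (i div ?d)) = (\<phi> ^^ n) ^^ (i div ?d)" by (simp add: funpow_mult mult.commute)
  finally have "n dvd n div ?d" using dvd\<sigma> by (simp add: \<phi>_order)
  moreover have "n div ?d > 0" using n_pos by (simp add: div_greater_zero_iff gcd_le2_nat)
  ultimately have "n \<le> n div ?d" by (rule dvd_imp_le)
  moreover have "?d \<noteq> 0" using n_pos by simp
  ultimately have "?d = 1"
    using n_pos div_less_dividend[of ?d n] by linarith
  then show "\<exists>i. coprime i n \<and> \<sigma> = \<phi> ^^ i" using i by (auto simp: coprime_iff_gcd_eq_1)
qed

end

section \<open>The four-term polynomials\<close>

text \<open>The polynomial \<open>psi\<close> with the inverse \<open>\<tau>\<close> and the involution \<open>s = \<sigma>\<^bsup>t\<^esup>\<close> as separate arguments: the codes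
  of \<open>\<sigma>\<^sup>-\<^sup>1\<close>, \<open>\<sigma>\<^bsup>t-1\<^esup>\<close> and \<open>\<sigma>\<^bsup>t+1\<^esup>\<close> then arise by permuting \<open>\<sigma>\<close>, \<open>\<tau>\<close>, \<open>s \<circ> \<sigma>\<close>, \<open>s \<circ> \<tau>\<close>.\<close>

definition Psi :: "('a::field \<Rightarrow> 'a) \<Rightarrow> ('a \<Rightarrow> 'a) \<Rightarrow> ('a \<Rightarrow> 'a) \<Rightarrow> 'a \<Rightarrow> 'a \<Rightarrow> 'a" where
  "Psi \<sigma> \<tau> s h x = \<sigma> x + s (\<tau> x) + h * \<sigma> h * s (\<sigma> x) + h * \<tau> (inverse h) * \<tau> x"

locale commuting_auts =
  fixes \<sigma> \<tau> s :: "'a::field \<Rightarrow> 'a"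
  assumes aut: "field_aut \<sigma>" "field_aut \<tau>" "field_aut s"
    and \<sigma>_\<tau> [simp]: "\<sigma> (\<tau> x) = x" and \<tau>_\<sigma> [simp]: "\<tau> (\<sigma> x) = x"
    and s_s [simp]: "s (s x) = x"
    and \<sigma>_s [simp]: "\<sigma> (s x) = s (\<sigma> x)"
begin

lemma \<tau>_s [simp]: "\<tau> (s x) = s (\<tau> x)"
  by (metis \<sigma>_\<tau> \<tau>_\<sigma> \<sigma>_s)

lemmas hom [simp] = field_autD[OF aut(1)] field_autD[OF aut(2)] field_autD[OF aut(3)]

text \<open>Pushes all automorphisms down to single variables and moves \<open>s\<close> outermost,
  so that \<open>algebra\<close> sees each iterate as one atom.\<close>

lemmas normal_form = hom \<sigma>_\<tau> \<tau>_\<sigma> s_s \<sigma>_s \<tau>_s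

text \<open>With \<open>s\<close> = \<sigma>^t the coefficients stand at the exponents 1, t-1, t+1,
  -1. The polynomials of \<sigma>, \<sigma>^(-1), \<sigma>^(t-1) and \<sigma>^(t+1) all have this
  support, so one composition formula covers every pair of them.\<close>

definition quad :: "'a \<Rightarrow> 'a \<Rightarrow> 'a \<Rightarrow> 'a \<Rightarrow> 'a \<Rightarrow> 'a" where
  "quad p1 p2 p3 p4 x = p1 * \<sigma> x + p2 * s (\<tau> x) + p3 * s (\<sigma> x) + p4 * \<tau> x"

lemma quad_comp:
  "quad p1 p2 p3 p4 (b * quad r1 r2 r3 r4 x) =
    (p1 * \<sigma> b * \<sigma> r4 + p4 * \<tau> b * \<tau> r1 + p2 * s (\<tau> b) * s (\<tau> r3) + p3 * s (\<sigma> b) * s (\<sigma> r2)) * x +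
    (p1 * \<sigma> b * \<sigma> r2 + p2 * s (\<tau> b) * s (\<tau> r1) + p3 * s (\<sigma> b) * s (\<sigma> r4) + p4 * \<tau> b * \<tau> r3) * s x +
    (p1 * \<sigma> b * \<sigma> r1 + p3 * s (\<sigma> b) * s (\<sigma> r3)) * \<sigma> (\<sigma> x) +
    (p1 * \<sigma> b * \<sigma> r3 + p3 * s (\<sigma> b) * s (\<sigma> r1)) * s (\<sigma> (\<sigma> x)) +
    (p4 * \<tau> b * \<tau> r4 + p2 * s (\<tau> b) * s (\<tau> r2)) * \<tau> (\<tau> x) +
    (p4 * \<tau> b * \<tau> r2 + p2 * s (\<tau> b) * s (\<tau> r4)) * s (\<tau> (\<tau> x))"
  by (simp only: quad_def normal_form) algebra

lemma quad_mult:
  "quad p1 p2 p3 p4 (a * x) = quad (p1 * \<sigma> a) (p2 * s (\<tau> a)) (p3 * s (\<sigma> a)) (p4 * \<tau> a) x"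
  by (simp only: quad_def normal_form) algebra

lemma Psi_eq_quad: "Psi \<sigma> \<tau> s h = quad 1 1 (h * \<sigma> h) (h / \<tau> h)"
  by (rule ext) (simp add: Psi_def quad_def divide_inverse)

lemma Psi_inverse_eq_quad: "Psi \<tau> \<sigma> s h = quad (h / \<sigma> h) (h * \<tau> h) 1 1"
  by (rule ext) (simp add: Psi_def quad_def divide_inverse)

text \<open>The involution cancels in the composite of \<open>s \<circ> \<tau>\<close> and
  \<open>s \<circ> \<sigma>\<close>. Hence identities proved for \<sigma> and its inverse transfer
  to \<sigma>^(t-1) and \<sigma>^(t+1).\<close>

lemma commuting_auts_twist: "commuting_auts (s \<circ> \<tau>) (s \<circ> \<sigma>) s"
  by unfold_locales (simp_all add: field_aut_comp aut)

lemma conj_iterates: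
  assumes "s h = - inverse h"
  shows "s (\<sigma> h) = - inverse (\<sigma> h)" "s (\<tau> h) = - inverse (\<tau> h)"
    "s (\<sigma> (\<sigma> h)) = - inverse (\<sigma> (\<sigma> h))" "s (\<tau> (\<tau> h)) = - inverse (\<tau> (\<tau> h))"
proof -
  show 1: "s (\<sigma> h) = - inverse (\<sigma> h)" "s (\<tau> h) = - inverse (\<tau> h)"
    using arg_cong[OF assms, of \<sigma>] arg_cong[OF assms, of \<tau>] by simp_all
  show "s (\<sigma> (\<sigma> h)) = - inverse (\<sigma> (\<sigma> h))" "s (\<tau> (\<tau> h)) = - inverse (\<tau> (\<tau> h))"
    using arg_cong[OF 1(1), of \<sigma>] arg_cong[OF 1(2), of \<tau>] by simp_all
qed

lemma Psi_twist_eq_quad: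
  assumes "s h = - inverse h"
  shows "Psi (s \<circ> \<tau>) (s \<circ> \<sigma>) s h = quad 1 1 (- (h * \<sigma> h)) (- (h / \<tau> h))"
  by (rule ext) (simp add: Psi_def quad_def conj_iterates[OF assms] divide_inverse add.commute add.left_commute)

lemma mult_iterates_ne_1:
  assumes "h * \<sigma> (\<sigma> h) \<noteq> 1"
  shows "\<tau> h * \<sigma> h \<noteq> 1" "\<tau> (\<tau> h) * h \<noteq> 1"
proof -
  show 1: "\<tau> h * \<sigma> h \<noteq> 1"
  proof
    assume "\<tau> h * \<sigma> h = 1"
    from arg_cong[OF this, of \<sigma>] show False using assms by simp
  qed
  show "\<tau> (\<tau> h) * h \<noteq> 1"
  proof
    assume "\<tau> (\<tau> h) * h = 1"
    from arg_cong[OF this, of \<sigma>] show False using 1 by simp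
  qed
qed

text \<open>Up to a constant, \<open>Psi \<tau> \<sigma> s (inverse h)\<close> is the inverse of \<open>b * Psi \<sigma> \<tau> s h\<close>; the factor \<open>b\<close>
  solves the equations that make the coefficients at \<open>\<sigma>\<^sup>2\<close>, \<open>\<sigma>\<^sup>-\<^sup>2\<close> and \<open>s\<close> vanish.\<close>

lemma Psi_inverse_comp:
  assumes h: "s h = - inverse h" "h \<noteq> 0" and w: "h * \<sigma> (\<sigma> h) \<noteq> 1"
  shows "\<exists>b c. b \<noteq> 0 \<and> c \<noteq> 0 \<and> (\<forall>x. Psi \<tau> \<sigma> s (inverse h) (b * Psi \<sigma> \<tau> s h x) = c * x)"
proof -
  define b where "b = \<tau> h / (h * (1 - \<tau> h * \<sigma> h))"
  note w12 = mult_iterates_ne_1[OF w]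
  have nz: "\<sigma> h \<noteq> 0" "\<tau> h \<noteq> 0" "\<sigma> (\<sigma> h) \<noteq> 0" "\<tau> (\<tau> h) \<noteq> 0"
    "1 - h * \<sigma> (\<sigma> h) \<noteq> 0" "1 - \<tau> (\<tau> h) * h \<noteq> 0"
    using h(2) w w12 by auto
  note sh = conj_iterates[OF h(1)]
  \<comment> \<open>These are the images under \<sigma> and \<tau> of the factor
    \<open>1 - \<tau> h * \<sigma> h\<close> in the denominator of \<open>b\<close>. They stay atoms
    while fractions are cleared. Since \<open>s\<close> inverts
    \<open>h * \<sigma> (\<sigma> h)\<close>, it maps \<open>W\<close> to a multiple of itself, and
    likewise \<open>V\<close>.\<close>
  define W V where W: "W = 1 - h * \<sigma> (\<sigma> h)" and V: "V = 1 - \<tau> (\<tau> h) * h"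
  have WV: "W \<noteq> 0" "V \<noteq> 0" using nz by (simp_all add: W V)
  have sW: "s W = - (W / (h * \<sigma> (\<sigma> h)))" and sV: "s V = - (V / (\<tau> (\<tau> h) * h))"
    unfolding W V using nz h(2) by (simp_all add: h(1) sh field_simps)
  have \<sigma>b: "\<sigma> b = h / (\<sigma> h * W)" and \<tau>b: "\<tau> b = \<tau> (\<tau> h) / (\<tau> h * V)"
    by (simp_all add: b_def W V)
  note vals = \<sigma>b \<tau>b sW sV h(1) sh
  have "Psi \<tau> \<sigma> s (inverse h) (b * Psi \<sigma> \<tau> s h x) = ((\<sigma> h - inverse (\<tau> h)) / h) * x" for x
  proof -
    \<comment> \<open>The six coefficients of the composite, with the trivial factors 1 left in so
      that they match the instance of \<open>quad_comp\<close> literally.\<close>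
    have "\<sigma> h / h * \<sigma> b * \<sigma> (h / \<tau> h) + 1 * \<tau> b * \<tau> 1 + inverse (h * \<tau> h) * s (\<tau> b) * s (\<tau> (h * \<sigma> h))
        + 1 * s (\<sigma> b) * s (\<sigma> 1) = (\<sigma> h - inverse (\<tau> h)) / h"
      using nz h(2) WV unfolding normal_form vals
      by (simp add: field_simps, simp add: W V) algebra
    moreover have "\<sigma> h / h * \<sigma> b * \<sigma> 1 + inverse (h * \<tau> h) * s (\<tau> b) * s (\<tau> 1)
        + 1 * s (\<sigma> b) * s (\<sigma> (h / \<tau> h)) + 1 * \<tau> b * \<tau> (h * \<sigma> h) = 0"
      using nz h(2) WV unfolding normal_form vals
      by (simp add: field_simps, simp add: W V) algebra
    moreover have "\<sigma> h / h * \<sigma> b * \<sigma> 1 + 1 * s (\<sigma> b) * s (\<sigma> (h * \<sigma> h)) = 0"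
      "\<sigma> h / h * \<sigma> b * \<sigma> (h * \<sigma> h) + 1 * s (\<sigma> b) * s (\<sigma> 1) = 0"
      "1 * \<tau> b * \<tau> (h / \<tau> h) + inverse (h * \<tau> h) * s (\<tau> b) * s (\<tau> 1) = 0"
      "1 * \<tau> b * \<tau> 1 + inverse (h * \<tau> h) * s (\<tau> b) * s (\<tau> (h / \<tau> h)) = 0"
      using nz h(2) WV unfolding normal_form vals
      by (simp_all add: field_simps)
    moreover have "Psi \<tau> \<sigma> s (inverse h) = quad (\<sigma> h / h) (inverse (h * \<tau> h)) 1 1"
      by (simp add: Psi_inverse_eq_quad divide_inverse mult.commute)
    ultimately show ?thesis
      by (simp only: Psi_eq_quad quad_comp) simp
  qed
  moreover have "(\<sigma> h - inverse (\<tau> h)) / h \<noteq> 0"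
    using w12 nz h(2) by (simp add: field_simps)
  moreover have "b \<noteq> 0"
    using w12 nz h(2) by (simp add: b_def)
  ultimately show ?thesis by blast
qed

text \<open>The witness is the one of \<open>Psi_inverse_comp\<close> multiplied by \<open>h * \<tau> g\<close>, where \<open>g\<close> absorbs the
  signs in \<open>Psi_twist_eq_quad\<close>.\<close>

lemma Psi_twist_comp:
  assumes h: "s h = - inverse h" "h \<noteq> 0" and w: "h * \<sigma> (\<sigma> h) \<noteq> 1"
    and g: "\<sigma> (\<sigma> g) = - g" "s g = g" "g \<noteq> 0"
  shows "\<exists>b c. b \<noteq> 0 \<and> c \<noteq> 0 \<and>
    (\<forall>x. Psi (s \<circ> \<tau>) (s \<circ> \<sigma>) s h (b * Psi \<sigma> \<tau> s h x) = c * x)"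
proof -
  define b where "b = \<tau> g * \<tau> h / (1 - \<tau> h * \<sigma> h)"
  note w12 = mult_iterates_ne_1[OF w]
  have nz: "\<sigma> h \<noteq> 0" "\<tau> h \<noteq> 0" "\<sigma> (\<sigma> h) \<noteq> 0" "\<tau> (\<tau> h) \<noteq> 0"
    "1 - h * \<sigma> (\<sigma> h) \<noteq> 0" "1 - \<tau> (\<tau> h) * h \<noteq> 0"
    using h(2) w w12 by auto
  note sh = conj_iterates[OF h(1)]
  have \<tau>g: "\<tau> (\<tau> g) = - g"
    using arg_cong[OF g(1), of "\<lambda>x. - \<tau> (\<tau> x)"] by simp
  define W V where W: "W = 1 - h * \<sigma> (\<sigma> h)" and V: "V = 1 - \<tau> (\<tau> h) * h"
  have WV: "W \<noteq> 0" "V \<noteq> 0" using nz by (simp_all add: W V)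
  have sW: "s W = - (W / (h * \<sigma> (\<sigma> h)))" and sV: "s V = - (V / (\<tau> (\<tau> h) * h))"
    unfolding W V using nz h(2) by (simp_all add: h(1) sh field_simps)
  have \<sigma>b: "\<sigma> b = g * h / W" and \<tau>b: "\<tau> b = - (g * \<tau> (\<tau> h) / V)"
    by (simp_all add: b_def W V \<tau>g)
  note vals = \<sigma>b \<tau>b sW sV h(1) sh g(2)
  have "Psi (s \<circ> \<tau>) (s \<circ> \<sigma>) s h (b * Psi \<sigma> \<tau> s h x) = (g * (\<sigma> h - inverse (\<tau> h))) * x" for x
  proof -
    have "1 * \<sigma> b * \<sigma> (h / \<tau> h) + - (h / \<tau> h) * \<tau> b * \<tau> 1 + 1 * s (\<tau> b) * s (\<tau> (h * \<sigma> h))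
        + - (h * \<sigma> h) * s (\<sigma> b) * s (\<sigma> 1) = g * (\<sigma> h - inverse (\<tau> h))"
      using nz h(2) WV unfolding normal_form vals
      by (simp add: field_simps, simp add: W V) algebra
    moreover have "1 * \<sigma> b * \<sigma> 1 + 1 * s (\<tau> b) * s (\<tau> 1)
        + - (h * \<sigma> h) * s (\<sigma> b) * s (\<sigma> (h / \<tau> h)) + - (h / \<tau> h) * \<tau> b * \<tau> (h * \<sigma> h) = 0"
      using nz h(2) WV unfolding normal_form vals
      by (simp add: field_simps, simp add: W V) algebra
    moreover have "1 * \<sigma> b * \<sigma> 1 + - (h * \<sigma> h) * s (\<sigma> b) * s (\<sigma> (h * \<sigma> h)) = 0"
      "1 * \<sigma> b * \<sigma> (h * \<sigma> h) + - (h * \<sigma> h) * s (\<sigma> b) * s (\<sigma> 1) = 0"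
      "- (h / \<tau> h) * \<tau> b * \<tau> (h / \<tau> h) + 1 * s (\<tau> b) * s (\<tau> 1) = 0"
      "- (h / \<tau> h) * \<tau> b * \<tau> 1 + 1 * s (\<tau> b) * s (\<tau> (h / \<tau> h)) = 0"
      using nz h(2) WV unfolding normal_form vals
      by (simp_all add: field_simps)
    ultimately show ?thesis
      by (simp only: Psi_eq_quad Psi_twist_eq_quad[OF h(1)] quad_comp) simp
  qed
  moreover have "g * (\<sigma> h - inverse (\<tau> h)) \<noteq> 0"
    using w12 nz g(3) by (simp add: field_simps)
  moreover have "b \<noteq> 0"
    using w12 nz g(3) by (simp add: b_def)
  ultimately show ?thesis by blast
qed

section \<open>Scalar multipliers\<close>

lemma quad_mult_eq:
  assumes "p1 * \<sigma> a = d * r1" "p2 * s (\<tau> a) = d * r2" "p3 * s (\<sigma> a) = d * r3" "p4 * \<tau> a = d * r4"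
  shows "quad p1 p2 p3 p4 (a * x) = d * quad r1 r2 r3 r4 x"
  unfolding quad_mult assms by (simp add: quad_def algebra_simps)

text \<open>The condition on \<open>s a\<close> exchanges the roles of \<open>\<sigma> a\<close> and
  \<open>\<tau> a\<close> under \<open>s\<close>, which settles the first two coefficients. The
  relation on \<open>m\<close> gives \<open>m / \<tau> m = m * \<sigma> m\<close>, so the other two
  coefficients impose one and the same equation on \<open>a\<close>.\<close>

lemma Psi_mult_unit:
  assumes m: "m * \<sigma> (\<sigma> m) = 1" and a: "s a = \<sigma> (\<sigma> a)" "m * \<sigma> m * \<tau> a = \<sigma> a" and "h \<noteq> 0"
  shows "Psi \<sigma> \<tau> s (m * h) (a * x) = \<sigma> a * Psi \<sigma> \<tau> s h x"
  unfolding Psi_eq_quad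
proof (rule quad_mult_eq)
  have m1: "\<tau> m * \<sigma> m = 1"
    using arg_cong[OF m, of \<tau>] by simp
  have s: "s (\<sigma> a) = \<tau> a" "s (\<tau> a) = \<sigma> a"
  proof -
    show 1: "s (\<tau> a) = \<sigma> a" using arg_cong[OF a(1), of \<tau>] by simp
    show "s (\<sigma> a) = \<tau> a" using arg_cong[OF 1, of s] by simp
  qed
  show "1 * \<sigma> a = \<sigma> a * 1" "1 * s (\<tau> a) = \<sigma> a * 1" by (simp_all add: s)
  have "(m * h * \<sigma> (m * h)) * s (\<sigma> a) = (m * \<sigma> m * \<tau> a) * (h * \<sigma> h)" by (simp add: s)
  then show "(m * h * \<sigma> (m * h)) * s (\<sigma> a) = \<sigma> a * (h * \<sigma> h)" by (simp add: a(2))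
  have "m / \<tau> m = m * \<sigma> m" using m1 by (metis divide_inverse inverse_unique)
  moreover have "m * h / \<tau> (m * h) * \<tau> a = (m / \<tau> m) * \<tau> a * (h / \<tau> h)"
    by simp
  ultimately have "m * h / \<tau> (m * h) * \<tau> a = (m * \<sigma> m * \<tau> a) * (h / \<tau> h)"
    by (simp only:)
  then show "m * h / \<tau> (m * h) * \<tau> a = \<sigma> a * (h / \<tau> h)" by (simp add: a(2))
qed

text \<open>By \<open>Psi_twist_eq_quad\<close> the two polynomials differ only in the signs of the
  last two coefficients. Both \<open>\<tau> a\<close> and \<open>s (\<sigma> a)\<close> equal
  \<open>- \<sigma> a\<close>, which undoes these signs. Such an \<open>a\<close> is available for t
  = 2 mod 4.\<close>

lemma Psi_twist_mult:
  assumes "s h = - inverse h" and a: "\<sigma> (\<sigma> a) = - a" "s a = - a"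
  shows "Psi (s \<circ> \<tau>) (s \<circ> \<sigma>) s h (a * x) = \<sigma> a * Psi \<sigma> \<tau> s h x"
proof -
  have "\<tau> a = - \<sigma> a"
    using arg_cong[OF a(1), of \<tau>] by simp
  moreover have "s (\<sigma> a) = - \<sigma> a"
    using arg_cong[OF a(2), of \<sigma>] by simp
  ultimately show ?thesis
    unfolding Psi_eq_quad Psi_twist_eq_quad[OF assms(1)]
    by (intro quad_mult_eq) (simp_all add: a)
qed

text \<open>Serves odd t, where \<open>\<sigma> a = - a\<close> implies \<open>s a = - a\<close>.
  The factor \<open>inverse h\<close> adjusts the sizes of the coefficients, and \<open>a\<close>
  compensates the sign in \<open>s h = - inverse h\<close>.\<close>

lemma Psi_inverse_mult:
  assumes h: "s h = - inverse h" "h \<noteq> 0" and a: "\<sigma> a = - a" "s a = - a"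
  shows "Psi \<tau> \<sigma> s (inverse h) (inverse h * a * x) = (- (a / h)) * Psi \<sigma> \<tau> s h x"
proof -
  have \<tau>a: "\<tau> a = - a"
    using arg_cong[OF a(1), of "\<lambda>x. - \<tau> x"] by simp
  show ?thesis
    unfolding Psi_eq_quad Psi_inverse_eq_quad using h(2)
    by (intro quad_mult_eq) (simp_all add: a \<tau>a h(1) conj_iterates[OF h(1)] field_simps)
qed

lemma Psi_uminus: "Psi \<sigma> \<tau> s (- h) = Psi \<sigma> \<tau> s h"
  by (simp add: Psi_eq_quad)

end

text \<open>In order, the exponents are 0, t, 1, t-1, t+1, -1, 2, t+2, -2, t-2: all that occur when
  a multiple of the identity plus a multiple of a \<open>quad\<close> is inserted into a
  \<open>quad\<close>.\<close>

locale independent_auts = commuting_auts +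
  assumes indep: "\<And>c0 c1 c2 c3 c4 c5 c6 c7 c8 c9.
    (\<And>x. c0 * x + c1 * s x + c2 * \<sigma> x + c3 * s (\<tau> x) + c4 * s (\<sigma> x) + c5 * \<tau> x
      + c6 * \<sigma> (\<sigma> x) + c7 * s (\<sigma> (\<sigma> x)) + c8 * \<tau> (\<tau> x) + c9 * s (\<tau> (\<tau> x)) = 0) \<Longrightarrow>
    c0 = 0 \<and> c1 = 0 \<and> c2 = 0 \<and> c3 = 0 \<and> c4 = 0 \<and> c5 = 0 \<and> c6 = 0 \<and> c7 = 0 \<and> c8 = 0 \<and> c9 = 0"
begin

lemma quad_comp_coeffs:
  assumes "\<And>x. quad p1 p2 p3 p4 (a * x + b * quad r1 r2 r3 r4 x) = c * x + d * quad r1 r2 r3 r4 x"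
  shows "p1 * \<sigma> b * \<sigma> r2 + p2 * s (\<tau> b) * s (\<tau> r1) + p3 * s (\<sigma> b) * s (\<sigma> r4) + p4 * \<tau> b * \<tau> r3 = 0"
    "p1 * \<sigma> b * \<sigma> r1 + p3 * s (\<sigma> b) * s (\<sigma> r3) = 0"
    "p4 * \<tau> b * \<tau> r4 + p2 * s (\<tau> b) * s (\<tau> r2) = 0"
    "p1 * \<sigma> a = d * r1" "p2 * s (\<tau> a) = d * r2" "p3 * s (\<sigma> a) = d * r3" "p4 * \<tau> a = d * r4"
proof -
  have add: "quad p1 p2 p3 p4 (u + v) = quad p1 p2 p3 p4 u + quad p1 p2 p3 p4 v" for u v
    by (simp add: quad_def algebra_simps)
  have "((p1 * \<sigma> b * \<sigma> r4 + p4 * \<tau> b * \<tau> r1 + p2 * s (\<tau> b) * s (\<tau> r3) + p3 * s (\<sigma> b) * s (\<sigma> r2)) - c) * x +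
    (p1 * \<sigma> b * \<sigma> r2 + p2 * s (\<tau> b) * s (\<tau> r1) + p3 * s (\<sigma> b) * s (\<sigma> r4) + p4 * \<tau> b * \<tau> r3) * s x +
    (p1 * \<sigma> a - d * r1) * \<sigma> x + (p2 * s (\<tau> a) - d * r2) * s (\<tau> x) +
    (p3 * s (\<sigma> a) - d * r3) * s (\<sigma> x) + (p4 * \<tau> a - d * r4) * \<tau> x +
    (p1 * \<sigma> b * \<sigma> r1 + p3 * s (\<sigma> b) * s (\<sigma> r3)) * \<sigma> (\<sigma> x) +
    (p1 * \<sigma> b * \<sigma> r3 + p3 * s (\<sigma> b) * s (\<sigma> r1)) * s (\<sigma> (\<sigma> x)) +
    (p4 * \<tau> b * \<tau> r4 + p2 * s (\<tau> b) * s (\<tau> r2)) * \<tau> (\<tau> x) +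
    (p4 * \<tau> b * \<tau> r2 + p2 * s (\<tau> b) * s (\<tau> r4)) * s (\<tau> (\<tau> x)) = 0" for x
    using assms[of x] unfolding add quad_comp
    unfolding quad_def normal_form by algebra
  from indep[OF this]
  show "p1 * \<sigma> b * \<sigma> r2 + p2 * s (\<tau> b) * s (\<tau> r1) + p3 * s (\<sigma> b) * s (\<sigma> r4) + p4 * \<tau> b * \<tau> r3 = 0"
    "p1 * \<sigma> b * \<sigma> r1 + p3 * s (\<sigma> b) * s (\<sigma> r3) = 0"
    "p4 * \<tau> b * \<tau> r4 + p2 * s (\<tau> b) * s (\<tau> r2) = 0"
    "p1 * \<sigma> a = d * r1" "p2 * s (\<tau> a) = d * r2" "p3 * s (\<sigma> a) = d * r3" "p4 * \<tau> a = d * r4"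
    by auto
qed

lemma Psi_equivalence_necessary:
  assumes h: "s h = - inverse h" "h \<noteq> 0" and k: "k \<noteq> 0" and ab: "a \<noteq> 0 \<or> b \<noteq> 0"
    and eq: "\<And>x. Psi \<sigma> \<tau> s k (a * x + b * Psi \<sigma> \<tau> s h x) = c * x + d * Psi \<sigma> \<tau> s h x"
  shows "k * \<sigma> (\<sigma> k) = h * \<sigma> (\<sigma> h)"
proof -
  note c = quad_comp_coeffs[OF eq[unfolded Psi_eq_quad]]
  note sh = conj_iterates[OF h(1)]
  have nz: "\<sigma> h \<noteq> 0" "\<tau> h \<noteq> 0" "\<sigma> (\<sigma> h) \<noteq> 0" "\<tau> (\<tau> h) \<noteq> 0" "\<sigma> k \<noteq> 0" "\<tau> k \<noteq> 0"
    using h(2) k by auto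
  show ?thesis
  proof (cases "a = 0")
    case False
    have 1: "s (\<tau> a) = \<sigma> a" using c(4,5) by simp
    have 2: "s (\<sigma> a) = \<tau> a" using arg_cong[OF 1, of s] by simp
    have 3: "k * \<sigma> k * \<tau> a = \<sigma> a * (h * \<sigma> h)" using c(6) c(4) by (simp add: 2)
    have 4: "k * \<tau> a * \<tau> h = \<sigma> a * h * \<tau> k" using c(7) c(4) nz by (simp add: field_simps)
    \<comment> \<open>Multiplying the equations at t+1 and -1 crosswise cancels everything that
      involves \<open>a\<close>.\<close>
    have "(k * \<tau> a * (\<sigma> a * h)) * (\<sigma> k * \<tau> k) = (k * \<tau> a * (\<sigma> a * h)) * (\<sigma> h * \<tau> h)"
      using 3 4 by algebra
    then have "\<sigma> k * \<tau> k = \<sigma> h * \<tau> h"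
      using False k h(2) by simp
    from arg_cong[OF this, of \<sigma>] show ?thesis by (simp add: mult.commute)
  next
    case True
    then have b: "b \<noteq> 0" using ab by simp
    have 1: "\<sigma> b * (\<sigma> h * \<sigma> (\<sigma> h)) = - (k * \<sigma> k * s (\<sigma> b))"
      using c(2) nz by (simp add: sh field_simps eq_neg_iff_add_eq_0)
    have "k * \<tau> b * \<tau> h = - (s (\<tau> b) * \<tau> (\<tau> h) * \<tau> k)"
      using c(3) nz by (simp add: sh field_simps eq_neg_iff_add_eq_0)
    \<comment> \<open>Applying \<sigma>^2 to the equation at -2 brings it to the unknowns
      \<open>\<sigma> b\<close> and \<open>s (\<sigma> b)\<close> of the equation at 2; the
      crosswise product then eliminates \<open>b\<close>.\<close>
    from arg_cong[OF arg_cong[OF this, of \<sigma>], of \<sigma>]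
    have 2: "\<sigma> (\<sigma> k) * \<sigma> b * \<sigma> h = - (s (\<sigma> b) * h * \<sigma> k)"
      by simp
    have "(\<sigma> b * s (\<sigma> b) * \<sigma> h * \<sigma> k) * (k * \<sigma> (\<sigma> k)) = (\<sigma> b * s (\<sigma> b) * \<sigma> h * \<sigma> k) * (h * \<sigma> (\<sigma> h))"
      using 1 2 by algebra
    then show ?thesis using nz b by simp
  qed
qed

lemma Psi_comp_Psi_notin:
  assumes h: "s h = - inverse h" "h \<noteq> 0" and two: "(2 :: 'a) \<noteq> 0"
    and eq: "\<And>x. b * Psi \<sigma> \<tau> s h (Psi \<sigma> \<tau> s h x) = c * x + d * Psi \<sigma> \<tau> s h x"
  shows "b = 0"
proof (rule ccontr)
  assume b: "b \<noteq> 0"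
  note sh = conj_iterates[OF h(1)]
  have nz: "\<sigma> h \<noteq> 0" "\<tau> h \<noteq> 0" "\<sigma> (\<sigma> h) \<noteq> 0" "\<tau> (\<tau> h) \<noteq> 0"
    using h(2) by auto
  \<comment> \<open>Dividing by \<open>b\<close> gives the shape of \<open>quad_comp_coeffs\<close>
    with inner scalars 0 and 1.\<close>
  have "Psi \<sigma> \<tau> s h (0 * x + 1 * Psi \<sigma> \<tau> s h x) = c / b * x + d / b * Psi \<sigma> \<tau> s h x" for x
    using eq[of x] b by (simp add: field_simps)
  note c = quad_comp_coeffs[OF this[unfolded Psi_eq_quad]]
  have 1: "\<sigma> (\<sigma> h) = - h"
    using c(2) nz by (simp add: sh field_simps eq_neg_iff_add_eq_0)
  have "2 * (1 + h * h) = 0"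
    using c(1) nz by (simp add: sh h(1) field_simps)
  then have "1 + h * h = 0"
    using two by (simp only: mult_eq_0_iff) simp
  then have 2: "h * h = - 1"
    by (simp add: eq_neg_iff_add_eq_0 add.commute)
  then have "\<sigma> h * \<sigma> h = h * h"
    using 2 by (metis hom(2) hom(4) hom(5))
  then have "\<sigma> h = h \<or> \<sigma> h = - h"
    by (simp add: square_eq_iff)
  then have "\<sigma> (\<sigma> h) = h" by auto
  then have "2 * h = 0" using 1 by (metis add.right_inverse mult_2)
  then show False using h(2) two by simp
qed

end

section \<open>Cyclic extensions of degree 2t\<close>

lemma field_aut_independent_family:
  assumes "finite I" "inj_on F I" "\<And>i. i \<in> I \<Longrightarrow> field_aut (F i)"
    and "\<And>x. (\<Sum>i\<in>I. c i * F i x) = 0" "j \<in> I"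
  shows "c j = 0"
proof -
  have "(\<Sum>f\<in>F ` I. c (the_inv_into I F f) * f x) = 0" for x
    using assms(4)[of x] by (simp add: sum.reindex[OF assms(2)] the_inv_into_f_f[OF assms(2)])
  from field_aut_independent[OF finite_imageI[OF assms(1)] _ this imageI[OF assms(5)]]
  have "c (the_inv_into I F (F j)) = 0"
    using assms(3) by blast
  then show ?thesis
    by (simp add: the_inv_into_f_f[OF assms(2,5)])
qed

lemma funpow_fixed: "(f ^^ d) x = x \<Longrightarrow> (f ^^ (d * j)) x = x"
  by (induction j) (simp_all add: funpow_add)

text \<open>Because of the order condition the exponent 2t-1 is the inverse, while t-1 and t+1 are
  the inverse and \<open>f\<close> followed by the involution.\<close>

lemma psi_eq_Psi:
  assumes "bij f" "f ^^ (2 * t) = id" "t > 0"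
  shows "psi h t f = Psi f (inv f) (f ^^ t) h"
proof
  fix x
  have f: "f (inv f x) = x" by (simp add: assms(1) bij_is_surj surj_f_inv_f)
  obtain r where r: "t = Suc r" using assms(3) by (metis gr0_implies_Suc)
  have 1: "(f ^^ (t - 1)) x = (f ^^ t) (inv f x)"
    by (simp add: r funpow_swap1 f)
  have "(f ^^ (2 * t - 1)) x = (f ^^ (2 * t - 1)) (f (inv f x))" by (simp add: f)
  also have "\<dots> = (f ^^ (2 * t)) (inv f x)"
    using r by (simp add: funpow_swap1)
  finally have 2: "(f ^^ (2 * t - 1)) x = inv f x" by (simp add: assms(2))
  have 3: "(f ^^ (t + 1)) x = (f ^^ t) (f x)"
    by (simp add: funpow_swap1)
  show "psi h t f x = Psi f (inv f) (f ^^ t) h x"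
    by (simp only: psi_def Psi_def 1 2 3)
qed

text \<open>The prime power q is absent: the exact order of \<sigma>, the commuting automorphisms
  and 2 \<noteq> 0 carry the argument, and norm conditions take the form
  \<open>s h = - inverse h\<close>.\<close>

locale even_cyclic_ext =
  fixes \<sigma> :: "'a::{field,finite} \<Rightarrow> 'a" and t :: nat
  assumes aut_\<sigma>: "field_aut \<sigma>" and order: "\<sigma> ^^ (2 * t) = id"
    and order_min: "\<And>i. i < 2 * t \<Longrightarrow> \<sigma> ^^ i = id \<Longrightarrow> i = 0"
    and t: "t \<ge> 5" and two: "(2 :: 'a) \<noteq> 0"
    and aut_commute: "\<And>\<rho> \<theta> (x :: 'a). field_aut \<rho> \<Longrightarrow> field_aut \<theta> \<Longrightarrow> \<rho> (\<theta> x) = \<theta> (\<rho> x)"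
begin

abbreviation \<tau> :: "'a \<Rightarrow> 'a" where "\<tau> \<equiv> inv \<sigma>"
abbreviation s :: "'a \<Rightarrow> 'a" where "s \<equiv> \<sigma> ^^ t"

sublocale commuting_auts \<sigma> \<tau> s
proof
  show "field_aut \<sigma>" "field_aut \<tau>" "field_aut s"
    by (intro aut_\<sigma> field_aut_inv field_aut_funpow)+
  have b: "bij \<sigma>" by (rule field_aut_bij[OF aut_\<sigma>])
  show "\<sigma> (\<tau> x) = x" "\<tau> (\<sigma> x) = x" for x
    using b by (simp_all add: bij_is_surj surj_f_inv_f bij_is_inj inv_f_f)
  show "s (s x) = x" for x
    using order by (metis comp_apply funpow_add id_apply mult_2)
  show "\<sigma> (s x) = s (\<sigma> x)" for x
    by (simp add: funpow_swap1)
qed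

lemma inj_on_\<sigma>_funpow: "inj_on (\<lambda>i. \<sigma> ^^ i) {..<2 * t}"
  by (intro inj_on_funpow_order order_min bij_is_inj field_aut_bij aut_\<sigma>)

lemma \<tau>_eq_funpow: "\<tau> x = (\<sigma> ^^ (2 * t - 1)) x"
proof -
  have "(\<sigma> ^^ (2 * t - 1)) (\<sigma> (\<tau> x)) = (\<sigma> ^^ Suc (2 * t - 1)) (\<tau> x)"
    by (simp only: funpow_Suc_right comp_apply)
  also have "Suc (2 * t - 1) = 2 * t" using t by simp
  finally show ?thesis by (simp add: order)
qed

sublocale independent_auts \<sigma> \<tau> s
proof
  fix c0 c1 c2 c3 c4 c5 c6 c7 c8 c9 :: 'a
  assume eq: "\<And>x. c0 * x + c1 * s x + c2 * \<sigma> x + c3 * s (\<tau> x) + c4 * s (\<sigma> x) + c5 * \<tau> x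
      + c6 * \<sigma> (\<sigma> x) + c7 * s (\<sigma> (\<sigma> x)) + c8 * \<tau> (\<tau> x) + c9 * s (\<tau> (\<tau> x)) = 0"
  \<comment> \<open>Now the exponents are 0, 1, 2, r+3, ..., r+7, 2r+8, 2r+9, visibly distinct and
    below 2t = 2r+10. For r = 0 they exhaust the whole range.\<close>
  obtain r where r: "t = r + 5" using t by (metis add.commute le_Suc_ex)
  have "2 * t - 1 = 2 * r + 9" by (simp add: r)
  then have \<tau>1: "(\<sigma> ^^ (2 * r + 9)) x = \<tau> x" for x
    by (simp only: \<tau>_eq_funpow)
  have \<tau>2: "(\<sigma> ^^ (2 * r + 8)) x = \<tau> (\<tau> x)" for x
  proof -
    have "(\<sigma> ^^ (2 * r + 8)) x = \<tau> (\<sigma> ((\<sigma> ^^ (2 * r + 8)) x))" by simp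
    also have "\<sigma> ((\<sigma> ^^ (2 * r + 8)) x) = (\<sigma> ^^ Suc (2 * r + 8)) x" by (simp only: funpow.simps comp_apply)
    also have "Suc (2 * r + 8) = 2 * r + 9" by simp
    finally show ?thesis by (simp only: \<tau>1)
  qed
  have s1: "(\<sigma> ^^ (r + 4)) x = s (\<tau> x)" for x
  proof -
    have "t = Suc (r + 4)" by (simp add: r)
    then have "s (\<tau> x) = (\<sigma> ^^ Suc (r + 4)) (\<tau> x)" by (simp only:)
    also have "\<dots> = (\<sigma> ^^ (r + 4)) (\<sigma> (\<tau> x))" by (simp only: funpow_Suc_right comp_apply)
    finally show ?thesis by simp
  qed
  have s2: "(\<sigma> ^^ (r + 3)) x = s (\<tau> (\<tau> x))" for x
  proof -
    have "s (\<tau> (\<tau> x)) = (\<sigma> ^^ (r + 4)) (\<tau> x)" by (simp only: s1)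
    also have "r + 4 = Suc (r + 3)" by simp
    also have "(\<sigma> ^^ Suc (r + 3)) (\<tau> x) = (\<sigma> ^^ (r + 3)) (\<sigma> (\<tau> x))"
      by (simp only: funpow_Suc_right comp_apply)
    finally show ?thesis by simp
  qed
  have s3: "(\<sigma> ^^ (r + 6)) x = s (\<sigma> x)" "(\<sigma> ^^ (r + 7)) x = s (\<sigma> (\<sigma> x))" for x
  proof -
    have "r + 6 = Suc t" "r + 7 = Suc (Suc t)" by (simp_all add: r)
    then show "(\<sigma> ^^ (r + 6)) x = s (\<sigma> x)" "(\<sigma> ^^ (r + 7)) x = s (\<sigma> (\<sigma> x))"
      by (simp_all only: funpow_Suc_right comp_apply)
  qed
  have s0: "(\<sigma> ^^ (r + 5)) x = s x" and \<sigma>2: "(\<sigma> ^^ 2) x = \<sigma> (\<sigma> x)" for x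
    by (simp_all add: r numeral_2_eq_2)
  have lt: "0 < t" "r + 5 < 2 * t" "Suc 0 < 2 * t" "r + 4 < 2 * t" "r + 6 < 2 * t" "2 * r + 9 < 2 * t"
    "2 < 2 * t" "r + 7 < 2 * t" "2 * r + 8 < 2 * t" "r + 3 < 2 * t"
    by (simp_all add: r)
  \<comment> \<open>\<open>D\<close> places one coefficient at one exponent, and \<open>C\<close>
    gathers all ten into a family over the exponents below 2t, as the independence lemma
    requires.\<close>
  define D where "D j c i = (if i = j then c else 0)" for j i :: nat and c :: 'a
  define C where "C i = D 0 c0 i + D (r + 5) c1 i + D 1 c2 i + D (r + 4) c3 i + D (r + 6) c4 i
      + D (2 * r + 9) c5 i + D 2 c6 i + D (r + 7) c7 i + D (2 * r + 8) c8 i + D (r + 3) c9 i" for i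
  have D: "(\<Sum>i<2 * t. D j c i * (\<sigma> ^^ i) x) = c * (\<sigma> ^^ j) x" if "j < 2 * t" for j c x
  proof -
    have "(\<Sum>i<2 * t. D j c i * (\<sigma> ^^ i) x) = (\<Sum>i<2 * t. if i = j then c * (\<sigma> ^^ j) x else 0)"
      by (intro sum.cong refl) (simp add: D_def)
    also have "\<dots> = c * (\<sigma> ^^ j) x" using that by simp
    finally show ?thesis .
  qed
  have "(\<Sum>i<2 * t. C i * (\<sigma> ^^ i) x) = 0" for x
  proof -
    have "(\<Sum>i<2 * t. C i * (\<sigma> ^^ i) x) = c0 * x + c1 * s x + c2 * \<sigma> x + c3 * s (\<tau> x) + c4 * s (\<sigma> x) + c5 * \<tau> x
      + c6 * \<sigma> (\<sigma> x) + c7 * s (\<sigma> (\<sigma> x)) + c8 * \<tau> (\<tau> x) + c9 * s (\<tau> (\<tau> x))"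
      unfolding C_def distrib_right sum.distrib
      by (simp add: D lt s0 \<tau>1 \<tau>2 s1 s2 s3 \<sigma>2)
    then show ?thesis using eq by simp
  qed
  then have C: "C i = 0" if "i < 2 * t" for i
    using that
    by (intro field_aut_independent_family[OF _ inj_on_\<sigma>_funpow, of C i])
      (simp_all add: field_aut_funpow aut_\<sigma>)
  show "c0 = 0 \<and> c1 = 0 \<and> c2 = 0 \<and> c3 = 0 \<and> c4 = 0 \<and> c5 = 0 \<and> c6 = 0 \<and> c7 = 0 \<and> c8 = 0 \<and> c9 = 0"
    using C[of 0] C[of "r + 5"] C[of 1] C[of "r + 4"] C[of "r + 6"] C[of "2 * r + 9"] C[of 2]
      C[of "r + 7"] C[of "2 * r + 8"] C[of "r + 3"] by (simp add: C_def D_def r)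
qed

text \<open>Applying \<sigma>^d to the alternating sum \<open>g z\<close> shifts its terms and flips
  its signs. The sum closes up because it has the even number 2t/d of terms, and independence of
  automorphisms yields a \<open>z\<close> at which it is nonzero.\<close>

lemma exists_antifixed:
  assumes d: "d > 0" "d dvd t"
  shows "\<exists>g. g \<noteq> 0 \<and> (\<sigma> ^^ d) g = - g"
proof -
  obtain m where m: "t = d * m" using d(2) by blast
  define g where "g z = (\<Sum>j<2 * m. (- 1) ^ j * (\<sigma> ^^ (d * j)) z)" for z
  have "\<exists>z. g z \<noteq> 0"
  proof (rule ccontr)
    assume "\<not> (\<exists>z. g z \<noteq> 0)"
    then have "(\<Sum>j<2 * m. (- 1) ^ j * (\<sigma> ^^ (d * j)) z) = 0" for z
      by (simp add: g_def)
    moreover have "inj_on (\<lambda>j. \<sigma> ^^ (d * j)) {..<2 * m}"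
    proof (rule inj_onI)
      fix i j assume ij: "i \<in> {..<2 * m}" "j \<in> {..<2 * m}" "\<sigma> ^^ (d * i) = \<sigma> ^^ (d * j)"
      then have "d * i = d * j"
        using d(1) by (intro inj_onD[OF inj_on_\<sigma>_funpow]) (auto simp: m)
      then show "i = j" using d(1) by simp
    qed
    moreover have "m > 0" using m t by (cases m) auto
    ultimately have "(- 1 :: 'a) ^ 0 = 0"
      by (intro field_aut_independent_family[of "{..<2 * m}" "\<lambda>j. \<sigma> ^^ (d * j)" "\<lambda>j. (- 1) ^ j" 0])
        (simp_all add: field_aut_funpow aut_\<sigma>)
    then show False by simp
  qed
  then obtain z where z: "g z \<noteq> 0" by blast
  have \<sigma>d: "field_aut (\<sigma> ^^ d)" by (intro field_aut_funpow aut_\<sigma>)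
  have "(\<sigma> ^^ d) (g z) = (\<Sum>j<2 * m. (- 1) ^ j * (\<sigma> ^^ (d * Suc j)) z)"
    unfolding g_def field_aut_sum[OF \<sigma>d]
    by (simp add: field_autD[OF \<sigma>d] funpow_add)
  also have "\<dots> = - (\<Sum>j<2 * m. (- 1) ^ Suc j * (\<sigma> ^^ (d * Suc j)) z)"
    by (simp add: sum_negf)
  also have "\<dots> = - (\<Sum>j<Suc (2 * m). (- 1) ^ j * (\<sigma> ^^ (d * j)) z) + z"
    by (subst sum.lessThan_Suc_shift) simp
  also have "\<dots> = - g z"
    using order by (simp add: g_def m mult.left_commute)
  finally show ?thesis using z by blast
qed

end

section \<open>Codes and their equivalence\<close>

definition span_with_id :: "('a::field \<Rightarrow> 'a) \<Rightarrow> ('a \<Rightarrow> 'a) set" where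
  "span_with_id P = {\<lambda>x. a * x + b * P x | a b. True}"

lemma psi_code_eq_span: "psi_code h t f = span_with_id (psi h t f)"
  by (simp add: psi_code_def span_with_id_def)

lemma mem_span_with_id: "f \<in> span_with_id P \<longleftrightarrow> (\<exists>a b. \<forall>x. f x = a * x + b * P x)"
  by (auto simp: span_with_id_def fun_eq_iff)

lemma span_with_id_scale:
  assumes "u \<in> span_with_id P"
  shows "(\<lambda>x. d * u x) \<in> span_with_id P"
proof -
  obtain a b where "u = (\<lambda>x. a * x + b * P x)"
    using assms by (auto simp: span_with_id_def)
  then have "(\<lambda>x. d * u x) = (\<lambda>x. (d * a) * x + (d * b) * P x)"
    by (simp add: algebra_simps)
  then show ?thesis unfolding span_with_id_def by blast
qed

lemma span_with_id_scale_image: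
  assumes "d \<noteq> 0"
  shows "(\<lambda>u x. d * u x) ` span_with_id P = span_with_id P"
proof (intro equalityI subsetI)
  fix u assume "u \<in> span_with_id P"
  then have "(\<lambda>x. inverse d * u x) \<in> span_with_id P" by (rule span_with_id_scale)
  then show "u \<in> (\<lambda>u x. d * u x) ` span_with_id P"
    using assms by (intro image_eqI[where x = "\<lambda>x. inverse d * u x"]) (simp_all add: mult.assoc[symmetric])
qed (auto intro: span_with_id_scale)

context even_cyclic_ext
begin

section \<open>The ring of \<sigma>-polynomials\<close>

abbreviation L :: "('a \<Rightarrow> 'a) set" where "L \<equiv> sigma_polys \<sigma> (2 * t)"
abbreviation unit_L :: "('a \<Rightarrow> 'a) \<Rightarrow> bool" where "unit_L \<equiv> invertible_sigma_poly \<sigma> (2 * t)"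

lemma L_additive: "f \<in> L \<Longrightarrow> f (x + y) = f x + f y"
  by (auto simp: sigma_polys_def sigma_poly_def field_autD[OF field_aut_funpow[OF aut_\<sigma>]]
      distrib_left sum.distrib)

lemma L_add: "f \<in> L \<Longrightarrow> g \<in> L \<Longrightarrow> (\<lambda>x. f x + g x) \<in> L"
proof -
  assume "f \<in> L" "g \<in> L"
  then obtain a b where "f = sigma_poly \<sigma> (2 * t) a" "g = sigma_poly \<sigma> (2 * t) b"
    by (auto simp: sigma_polys_def)
  then have "(\<lambda>x. f x + g x) = sigma_poly \<sigma> (2 * t) (\<lambda>i. a i + b i)"
    by (simp add: sigma_poly_def distrib_right sum.distrib)
  then show ?thesis by (auto simp: sigma_polys_def)
qed

lemma L_scale: "f \<in> L \<Longrightarrow> (\<lambda>x. c * f x) \<in> L"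
proof -
  assume "f \<in> L"
  then obtain a where "f = sigma_poly \<sigma> (2 * t) a"
    by (auto simp: sigma_polys_def)
  then have "(\<lambda>x. c * f x) = sigma_poly \<sigma> (2 * t) (\<lambda>i. c * a i)"
    by (simp add: sigma_poly_def sum_distrib_left mult.assoc)
  then show ?thesis by (auto simp: sigma_polys_def)
qed

lemma L_zero: "(\<lambda>x. 0) \<in> L"
  by (auto simp: sigma_polys_def sigma_poly_def intro!: image_eqI[of _ _ "\<lambda>_. 0"])

lemma L_id: "id \<in> L"
proof -
  have "id = sigma_poly \<sigma> (2 * t) (\<lambda>i. if i = 0 then 1 else 0)"
  proof
    fix x
    have "(\<Sum>i<2 * t. (if i = 0 then 1 else 0) * (\<sigma> ^^ i) x) = (\<Sum>i<2 * t. if i = 0 then x else 0)"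
      by (intro sum.cong refl) simp
    then show "id x = sigma_poly \<sigma> (2 * t) (\<lambda>i. if i = 0 then 1 else 0) x"
      using t by (simp add: sigma_poly_def)
  qed
  then show ?thesis by (auto simp: sigma_polys_def)
qed

text \<open>The coefficients are mapped by \<sigma> and shifted cyclically; the top one wraps around
  to index 0 since \<sigma>^(2t) = id.\<close>

lemma L_\<sigma>: "f \<in> L \<Longrightarrow> (\<lambda>x. \<sigma> (f x)) \<in> L"
proof -
  assume "f \<in> L"
  then obtain a where a: "f = sigma_poly \<sigma> (2 * t) a"
    by (auto simp: sigma_polys_def)
  obtain m where m: "2 * t = Suc m" using t by (cases "2 * t") auto
  define b where "b i = (case i of 0 \<Rightarrow> \<sigma> (a m) | Suc j \<Rightarrow> \<sigma> (a j))" for i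
  have "\<sigma> (f x) = sigma_poly \<sigma> (2 * t) b x" for x
  proof -
    have "\<sigma> (f x) = (\<Sum>i<m. \<sigma> (a i) * (\<sigma> ^^ Suc i) x) + \<sigma> (a m) * (\<sigma> ^^ Suc m) x"
      by (simp add: a sigma_poly_def m field_aut_sum[OF aut_\<sigma>])
    also have "(\<sigma> ^^ Suc m) x = x" using order by (simp flip: m del: funpow.simps)
    finally show ?thesis
      unfolding sigma_poly_def m sum.lessThan_Suc_shift by (simp add: b_def add.commute)
  qed
  then have "(\<lambda>x. \<sigma> (f x)) = sigma_poly \<sigma> (2 * t) b" by auto
  then show ?thesis by (auto simp: sigma_polys_def)
qed

lemma L_\<sigma>_funpow: "f \<in> L \<Longrightarrow> (\<lambda>x. (\<sigma> ^^ i) (f x)) \<in> L"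
  by (induction i) (simp_all add: L_\<sigma>)

lemma L_comp: "f \<in> L \<Longrightarrow> g \<in> L \<Longrightarrow> f \<circ> g \<in> L"
proof -
  assume "f \<in> L" and g: "g \<in> L"
  then obtain a where a: "f = sigma_poly \<sigma> (2 * t) a"
    by (auto simp: sigma_polys_def)
  have "(\<lambda>x. \<Sum>i<m. a i * (\<sigma> ^^ i) (g x)) \<in> L" for m
    by (induction m) (simp_all add: L_zero L_add L_scale L_\<sigma>_funpow g)
  then show ?thesis by (simp add: a sigma_poly_def comp_def)
qed

lemma L_funpow: "\<sigma> ^^ i \<in> L"
  using L_\<sigma>_funpow[OF L_id, of i] by (simp add: eta_contract_eq)

lemma span_subset_L: "P \<in> L \<Longrightarrow> span_with_id P \<subseteq> L"
  using L_scale[OF L_id] by (auto simp: span_with_id_def intro!: L_add L_scale[of P])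

lemma unit_L_comp: "unit_L f \<Longrightarrow> unit_L g \<Longrightarrow> unit_L (f \<circ> g)"
proof -
  assume "unit_L f" "unit_L g"
  then obtain f' g' where *: "f \<in> L" "f' \<in> L" "f \<circ> f' = id" "f' \<circ> f = id"
     "g \<in> L" "g' \<in> L" "g \<circ> g' = id" "g' \<circ> g = id"
    by (auto simp: invertible_sigma_poly_def)
  then have "(f \<circ> g) \<circ> (g' \<circ> f') = id" "(g' \<circ> f') \<circ> (f \<circ> g) = id"
    by (simp_all add: fun_eq_iff)
  then show ?thesis using * L_comp by (auto simp: invertible_sigma_poly_def)
qed

lemma unit_L_inverse: "unit_L f \<Longrightarrow> \<exists>g. unit_L g \<and> f \<circ> g = id \<and> g \<circ> f = id"
  by (auto simp: invertible_sigma_poly_def)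

text \<open>A left inverse up to a constant makes \<open>f\<close> injective, hence bijective on the
  finite field, so the left inverse is two-sided.\<close>

lemma unit_LI:
  assumes "f \<in> L" "P \<in> L" "c \<noteq> 0" "\<And>x. P (f x) = c * x"
  shows "unit_L f"
proof -
  let ?g = "\<lambda>x. inverse c * P x"
  have gf: "?g \<circ> f = id" using assms by (auto simp: fun_eq_iff)
  then have "inj f" by (metis inj_on_id inj_on_imageI2)
  then have "surj f" by (simp add: finite_UNIV_inj_surj)
  have "f \<circ> ?g = id"
  proof
    fix y
    obtain x where "y = f x" using \<open>surj f\<close> by blast
    then show "(f \<circ> ?g) y = id y" using gf by (simp add: fun_eq_iff)
  qed
  moreover have "?g \<in> L" by (intro L_scale assms)
  ultimately show ?thesis using gf assms(1) by (auto simp: invertible_sigma_poly_def)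
qed

lemma unit_L_mult: "c \<noteq> 0 \<Longrightarrow> unit_L (\<lambda>x. c * x)"
  using L_scale[OF L_id, of c] L_scale[OF L_id, of "inverse c"]
  by (intro unit_LI[of _ "\<lambda>x. inverse c * x" 1]) (auto simp: id_def)

text \<open>Equivalence with trivial left factor and trivial field automorphism, the part that
  remains after \<open>code_equivalent_iff\<close>.\<close>

definition right_equiv :: "('a \<Rightarrow> 'a) set \<Rightarrow> ('a \<Rightarrow> 'a) set \<Rightarrow> bool" where
  "right_equiv C1 C2 \<longleftrightarrow> (\<exists>f. unit_L f \<and> C1 = (\<lambda>g. g \<circ> f) ` C2)"

lemma right_equiv_sym: "right_equiv C1 C2 \<Longrightarrow> right_equiv C2 C1"
proof -
  assume "right_equiv C1 C2"
  then obtain f where f: "unit_L f" "C1 = (\<lambda>g. g \<circ> f) ` C2" by (auto simp: right_equiv_def)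
  obtain f' where f': "unit_L f'" "f \<circ> f' = id" using unit_L_inverse[OF f(1)] by blast
  have "(\<lambda>g. g \<circ> f') ` C1 = C2"
    by (simp add: f(2) image_image comp_assoc f'(2))
  then show ?thesis using f'(1) by (auto simp: right_equiv_def)
qed

lemma right_equiv_trans: "right_equiv C1 C2 \<Longrightarrow> right_equiv C2 C3 \<Longrightarrow> right_equiv C1 C3"
proof -
  assume "right_equiv C1 C2" "right_equiv C2 C3"
  then obtain f g where "unit_L f" "C1 = (\<lambda>u. u \<circ> f) ` C2" "unit_L g" "C2 = (\<lambda>u. u \<circ> g) ` C3"
    by (auto simp: right_equiv_def)
  then show ?thesis
    unfolding right_equiv_def
    by (intro exI[of _ "g \<circ> f"]) (simp add: unit_L_comp image_image comp_assoc)
qed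

lemma right_equiv_mult:
  assumes "a \<noteq> 0" "d \<noteq> 0" "\<And>x. P (a * x) = d * Q x"
  shows "right_equiv (span_with_id Q) (span_with_id P)"
  unfolding right_equiv_def
proof (intro exI[of _ "\<lambda>x. a * x"] conjI unit_L_mult assms(1))
  show "span_with_id Q = (\<lambda>g. g \<circ> (\<lambda>x. a * x)) ` span_with_id P"
  proof (intro equalityI subsetI)
    fix f assume "f \<in> span_with_id Q"
    then obtain u v where f: "f = (\<lambda>x. u * x + v * Q x)" by (auto simp: span_with_id_def)
    have "f = (\<lambda>x. (u / a) * x + (v / d) * P x) \<circ> (\<lambda>x. a * x)"
      using assms by (simp add: f fun_eq_iff)
    then show "f \<in> (\<lambda>g. g \<circ> (\<lambda>x. a * x)) ` span_with_id P"
      unfolding span_with_id_def by blast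
  next
    fix f assume "f \<in> (\<lambda>g. g \<circ> (\<lambda>x. a * x)) ` span_with_id P"
    then obtain u v where f: "f = (\<lambda>x. u * x + v * P x) \<circ> (\<lambda>x. a * x)"
      by (auto simp: span_with_id_def)
    have "f = (\<lambda>x. (u * a) * x + (v * d) * Q x)"
      using assms(3) by (simp add: f fun_eq_iff mult.assoc)
    then show "f \<in> span_with_id Q" unfolding span_with_id_def by blast
  qed
qed

text \<open>Composition with \<open>b * Q\<close> sends the identity to a multiple of
  \<open>Q\<close> and \<open>P\<close> to a multiple of the identity, so the two generators change
  places.\<close>

lemma right_equiv_inverse:
  assumes "P \<in> L" "Q \<in> L" "b \<noteq> 0" "c \<noteq> 0" "\<And>x. P (b * Q x) = c * x"
  shows "right_equiv (span_with_id Q) (span_with_id P)"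
  unfolding right_equiv_def
proof (intro exI[of _ "\<lambda>x. b * Q x"] conjI)
  show "unit_L (\<lambda>x. b * Q x)"
    using assms by (intro unit_LI[of _ P c]) (auto intro: L_scale)
  show "span_with_id Q = (\<lambda>g. g \<circ> (\<lambda>x. b * Q x)) ` span_with_id P"
  proof (intro equalityI subsetI)
    fix f assume "f \<in> span_with_id Q"
    then obtain u v where f: "f = (\<lambda>x. u * x + v * Q x)" by (auto simp: span_with_id_def)
    have "f = (\<lambda>x. (v / b) * x + (u / c) * P x) \<circ> (\<lambda>x. b * Q x)"
      using assms by (simp add: f fun_eq_iff)
    then show "f \<in> (\<lambda>g. g \<circ> (\<lambda>x. b * Q x)) ` span_with_id P"
      unfolding span_with_id_def by blast
  next
    fix f assume "f \<in> (\<lambda>g. g \<circ> (\<lambda>x. b * Q x)) ` span_with_id P"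
    then obtain u v where f: "f = (\<lambda>x. u * x + v * P x) \<circ> (\<lambda>x. b * Q x)"
      by (auto simp: span_with_id_def)
    have "f = (\<lambda>x. (v * c) * x + (u * b) * Q x)"
      using assms(5) by (simp add: f fun_eq_iff mult.assoc)
    then show "f \<in> span_with_id Q" unfolding span_with_id_def by blast
  qed
qed

section \<open>Equivalence and field automorphisms\<close>

lemma psi_twist:
  fixes \<rho> f :: "'a \<Rightarrow> 'a"
  assumes \<rho>: "field_aut \<rho>" and f: "field_aut f"
  shows "\<rho> (psi k m f (inv \<rho> x)) = psi (\<rho> k) m f x"
proof -
  have \<rho>i: "\<rho> (inv \<rho> y) = y" for y
    by (simp add: field_aut_bij[OF \<rho>] bij_is_surj surj_f_inv_f)
  have c: "\<rho> ((f ^^ i) (inv \<rho> x)) = (f ^^ i) x" "\<rho> (f y) = f (\<rho> y)" "\<rho> (inv f y) = inv f (\<rho> y)" for i y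
    by (simp_all add: aut_commute[OF \<rho>] field_aut_funpow field_aut_inv f \<rho>i)
  show ?thesis
    by (simp add: psi_def field_autD[OF \<rho>] c \<rho>i)
qed

lemma psi_in_L:
  assumes "\<And>i. f ^^ i \<in> L" "bij f" "f ^^ (2 * m) = id" "m > 0"
  shows "psi k m f \<in> L"
  unfolding psi_def by (intro L_add L_scale assms) (use assms(1)[of 1] in simp)

lemma psi_code_twist:
  fixes \<rho> f :: "'a \<Rightarrow> 'a"
  assumes \<rho>: "field_aut \<rho>" and f: "field_aut f"
  shows "(\<lambda>g. \<rho> \<circ> g \<circ> inv \<rho>) ` psi_code k t f = psi_code (\<rho> k) t f"
proof -
  have \<rho>i: "\<rho> (inv \<rho> y) = y" "inv \<rho> (\<rho> y) = y" for y
    using field_aut_bij[OF \<rho>] by (simp_all add: bij_is_surj surj_f_inv_f bij_is_inj inv_f_f)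
  show ?thesis
  proof (intro equalityI subsetI)
    fix g assume "g \<in> (\<lambda>g. \<rho> \<circ> g \<circ> inv \<rho>) ` psi_code k t f"
    then obtain u v where g: "g = \<rho> \<circ> (\<lambda>x. u * x + v * psi k t f x) \<circ> inv \<rho>"
      by (auto simp: psi_code_def)
    have "g = (\<lambda>x. \<rho> u * x + \<rho> v * psi (\<rho> k) t f x)"
      by (simp add: g fun_eq_iff field_autD[OF \<rho>] \<rho>i psi_twist[OF \<rho> f])
    then show "g \<in> psi_code (\<rho> k) t f" unfolding psi_code_def by blast
  next
    fix g assume "g \<in> psi_code (\<rho> k) t f"
    then obtain u v where g: "g = (\<lambda>x. u * x + v * psi (\<rho> k) t f x)"
      by (auto simp: psi_code_def)
    have "g = \<rho> \<circ> (\<lambda>x. inv \<rho> u * x + inv \<rho> v * psi k t f x) \<circ> inv \<rho>"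
      by (simp add: g fun_eq_iff field_autD[OF \<rho>] \<rho>i psi_twist[OF \<rho> f])
    then show "g \<in> (\<lambda>g. \<rho> \<circ> g \<circ> inv \<rho>) ` psi_code k t f"
      unfolding psi_code_def by blast
  qed
qed

text \<open>Since \<open>\<psi> \<circ> \<psi>\<close> is not in the code, its left idealiser consists of the scalars. So \<open>f1\<close>
  normalises the scalars and is a multiple of a field automorphism \<open>\<theta>\<close>, which can be moved into the
  right factor.\<close>

lemma code_equivalent_iff:
  assumes h: "s h = - inverse h" "h \<noteq> 0" and f: "field_aut f" "\<And>k. psi k t f \<in> L"
  shows "code_equivalent \<sigma> (2 * t) (psi_code h t \<sigma>) (psi_code k t f) \<longleftrightarrow>
    (\<exists>\<rho>. field_aut \<rho> \<and> right_equiv (psi_code h t \<sigma>) (psi_code (\<rho> k) t f))"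
proof -
  let ?C = "psi_code h t \<sigma>"
  \<comment> \<open>Since \<rho> commutes with \<sigma>, applying \<rho> to the coefficients is
    conjugation by \<rho>; on the codes this only replaces \<open>k\<close> by
    \<open>\<rho> k\<close>.\<close>
  have twist: "{f1 \<circ> sigma_poly \<sigma> (2 * t) (\<rho> \<circ> a) \<circ> f2 | a. sigma_poly \<sigma> (2 * t) a \<in> psi_code k t f} =
      (\<lambda>g. f1 \<circ> g \<circ> f2) ` psi_code (\<rho> k) t f" if \<rho>: "field_aut \<rho>" for \<rho> f1 f2 k
  proof -
    have \<rho>i: "\<rho> (inv \<rho> y) = y" "inv \<rho> (\<rho> y) = y" for y
      using field_aut_bij[OF \<rho>] by (simp_all add: bij_is_surj surj_f_inv_f bij_is_inj inv_f_f)
    have poly: "sigma_poly \<sigma> (2 * t) (\<rho> \<circ> a) = \<rho> \<circ> sigma_poly \<sigma> (2 * t) a \<circ> inv \<rho>" for a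
      by (simp add: fun_eq_iff sigma_poly_def field_aut_sum[OF \<rho>] field_autD[OF \<rho>]
          aut_commute[OF \<rho> field_aut_funpow[OF aut_\<sigma>]] \<rho>i)
    note code = psi_code_twist[OF \<rho> f(1), of k]
    have sub: "psi_code k t f \<subseteq> range (sigma_poly \<sigma> (2 * t))"
      using span_subset_L[OF f(2)] by (simp add: psi_code_eq_span sigma_polys_def)
    show ?thesis
      unfolding code[symmetric] image_image poly
    proof (intro equalityI subsetI)
      fix u assume "u \<in> (\<lambda>g. f1 \<circ> (\<rho> \<circ> g \<circ> inv \<rho>) \<circ> f2) ` psi_code k t f"
      then obtain g where g: "g \<in> psi_code k t f" "u = f1 \<circ> (\<rho> \<circ> g \<circ> inv \<rho>) \<circ> f2" by blast
      then obtain a where "g = sigma_poly \<sigma> (2 * t) a" using sub by blast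
      then show "u \<in> {f1 \<circ> (\<rho> \<circ> sigma_poly \<sigma> (2 * t) a \<circ> inv \<rho>) \<circ> f2 |a.
          sigma_poly \<sigma> (2 * t) a \<in> psi_code k t f}"
        using g by blast
    qed auto
  qed
  have psi_h: "psi h t \<sigma> = Psi \<sigma> \<tau> s h"
    using t by (intro psi_eq_Psi field_aut_bij aut_\<sigma> order) simp
  have "psi h t \<sigma> \<in> L"
    using t by (intro psi_in_L L_funpow field_aut_bij aut_\<sigma> order) simp
  then have sub: "?C \<subseteq> L" "psi_code k t f \<subseteq> L" for k
    using f(2) by (simp_all add: psi_code_eq_span span_subset_L)
  show ?thesis
  proof
    assume "\<exists>\<rho>. field_aut \<rho> \<and> right_equiv ?C (psi_code (\<rho> k) t f)"
    then obtain \<rho> f2 where \<rho>: "field_aut \<rho>" and f2: "unit_L f2"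
      and C: "?C = (\<lambda>g. id \<circ> g \<circ> f2) ` psi_code (\<rho> k) t f"
      by (auto simp: right_equiv_def)
    have "unit_L id" using L_id by (auto simp: invertible_sigma_poly_def)
    then show "code_equivalent \<sigma> (2 * t) ?C (psi_code k t f)"
      unfolding code_equivalent_def
      using sub f2 \<rho> C[folded twist[OF \<rho>]] by blast
  next
    assume "code_equivalent \<sigma> (2 * t) ?C (psi_code k t f)"
    then obtain f1 f2 \<rho> where f12: "unit_L f1" "unit_L f2" and \<rho>: "field_aut \<rho>"
      and C': "?C = {f1 \<circ> sigma_poly \<sigma> (2 * t) (\<rho> \<circ> a) \<circ> f2 | a. sigma_poly \<sigma> (2 * t) a \<in> psi_code k t f}"
      unfolding code_equivalent_def by blast
    note C = C'[unfolded twist[OF \<rho>]]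
    obtain g1 where g1: "unit_L g1" "f1 \<circ> g1 = id" "g1 \<circ> f1 = id"
      using unit_L_inverse[OF f12(1)] by blast
    have fg: "f1 (g1 x) = x" "g1 (f1 x) = x" for x
      using g1 by (simp_all add: fun_eq_iff)
    have f1L: "f1 \<in> L" using f12(1) by (simp add: invertible_sigma_poly_def)
    have f1_0: "f1 0 = 0" using L_additive[OF f1L, of 0 0] by (metis add.right_neutral add_left_cancel)
    \<comment> \<open>Left scalars preserve the second code, so their conjugates by
      \<open>f1\<close> lie in the left idealiser of \<open>?C\<close>.\<close>
    have scale: "(\<lambda>x. f1 (a * g1 (u x))) \<in> ?C" if "u \<in> ?C" for a u
    proof -
      from that have "u \<in> (\<lambda>g. f1 \<circ> g \<circ> f2) ` psi_code (\<rho> k) t f" by (simp only: C)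
      then obtain v where v: "v \<in> psi_code (\<rho> k) t f" "u = f1 \<circ> v \<circ> f2" by (elim imageE)
      have "(\<lambda>x. a * v x) \<in> psi_code (\<rho> k) t f"
        using v(1) by (simp add: psi_code_eq_span span_with_id_scale)
      then have "f1 \<circ> (\<lambda>x. a * v x) \<circ> f2 \<in> ?C" unfolding C by (rule imageI)
      moreover have "f1 \<circ> (\<lambda>x. a * v x) \<circ> f2 = (\<lambda>x. f1 (a * g1 (u x)))"
        by (simp add: v(2) fg fun_eq_iff)
      ultimately show ?thesis by simp
    qed
    have mem: "(\<lambda>x. a * x + b * Psi \<sigma> \<tau> s h x) \<in> ?C" for a b
      unfolding psi_code_def psi_h by blast
    \<comment> \<open>Applied to the identity, the conjugate of \<open>a\<close> is seen to be c + d
      psi; applied to psi, it puts d psi o psi into the code, whence d = 0.\<close>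
    have "\<exists>c. \<forall>x. f1 (a * g1 x) = c * x" for a
    proof -
      have "(\<lambda>x. f1 (a * g1 x)) \<in> ?C" using scale[OF mem[of 1 0], of a] by simp
      then obtain c d where cd: "f1 (a * g1 x) = c * x + d * Psi \<sigma> \<tau> s h x" for x
        by (auto simp: psi_code_def psi_h fun_eq_iff)
      have "(\<lambda>x. f1 (a * g1 (Psi \<sigma> \<tau> s h x))) \<in> ?C" using scale[OF mem[of 0 1], of a] by simp
      then obtain u v where "f1 (a * g1 (Psi \<sigma> \<tau> s h x)) = u * x + v * Psi \<sigma> \<tau> s h x" for x
        by (auto simp: psi_code_def psi_h fun_eq_iff)
      then have "c * Psi \<sigma> \<tau> s h x + d * Psi \<sigma> \<tau> s h (Psi \<sigma> \<tau> s h x) = u * x + v * Psi \<sigma> \<tau> s h x" for x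
        by (simp add: cd)
      then have "d * Psi \<sigma> \<tau> s h (Psi \<sigma> \<tau> s h x) = u * x + (v - c) * Psi \<sigma> \<tau> s h x" for x
        by (simp add: algebra_simps eq_diff_eq)
      then have "d = 0" by (rule Psi_comp_Psi_notin[OF h two])
      then show ?thesis using cd by auto
    qed
    then obtain \<theta> where "f1 (a * g1 x) = \<theta> a * x" for a x by metis
    then have \<theta>: "f1 (a * y) = \<theta> a * f1 y" for a y by (metis fg(2))
    define c where "c = f1 1"
    have c0: "c \<noteq> 0" using f1_0 fg(2) by (metis c_def zero_neq_one)
    have f1: "f1 y = c * \<theta> y" for y using \<theta>[of y 1] by (simp add: c_def mult.commute)
    have \<theta>aut_\<sigma>: "field_aut \<theta>"
      unfolding field_aut_def
    proof (intro conjI allI)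
      have "inj \<theta>"
      proof (rule injI)
        fix x y assume "\<theta> x = \<theta> y"
        then show "x = y" using f1 fg(2) by metis
      qed
      then show "bij \<theta>" by (simp add: bij_def finite_UNIV_inj_surj)
      show "\<theta> (x + y) = \<theta> x + \<theta> y" for x y
        using L_additive[OF f1L, of x y] c0 by (simp add: f1 flip: distrib_left)
      show "\<theta> (x * y) = \<theta> x * \<theta> y" for x y
        using \<theta>[of x y] c0 by (simp add: f1)
    qed
    \<comment> \<open>The new right factor must again be a \<sigma>-polynomial; it is one because
      \<theta> is a scalar multiple of \<open>f1\<close>.\<close>
    have "unit_L ((\<lambda>x. inverse c * x) \<circ> f1 \<circ> f2)"
      using c0 f12 by (intro unit_L_comp unit_L_mult) auto
    also have "(\<lambda>x. inverse c * x) \<circ> f1 \<circ> f2 = \<theta> \<circ> f2"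
      using c0 by (simp add: fun_eq_iff f1)
    finally have unit: "unit_L (\<theta> \<circ> f2)" .
    have \<theta>i: "inv \<theta> (\<theta> y) = y" for y
      using field_aut_bij[OF \<theta>aut_\<sigma>] by (simp add: bij_is_inj inv_f_f)
    have "?C = (\<lambda>u x. inverse c * u x) ` ?C"
      using c0 by (simp add: psi_code_eq_span span_with_id_scale_image)
    also have "\<dots> = (\<lambda>g. \<theta> \<circ> g \<circ> f2) ` psi_code (\<rho> k) t f"
      unfolding C image_image using c0 by (simp add: comp_def f1 mult.assoc[symmetric])
    also have "\<dots> = (\<lambda>g. g \<circ> (\<theta> \<circ> f2)) ` psi_code (\<theta> (\<rho> k)) t f"
      unfolding psi_code_twist[OF \<theta>aut_\<sigma> f(1), symmetric] image_image
      by (simp add: comp_def \<theta>i)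
    finally have "right_equiv ?C (psi_code ((\<theta> \<circ> \<rho>) k) t f)"
      using unit by (auto simp: right_equiv_def)
    then show "\<exists>\<rho>. field_aut \<rho> \<and> right_equiv ?C (psi_code (\<rho> k) t f)"
      using field_aut_comp[OF \<theta>aut_\<sigma> \<rho>] by blast
  qed
qed

end

text \<open>Either equation makes the fourth power of its automorphism, \<sigma> or \<phi>, fix
  \<open>m\<close>. Since \<phi> is a power of \<sigma>, in both cases \<phi>^4 fixes
  \<open>m\<close>. As \<sigma> = \<phi>^i with odd i, the exponent 2i is 2 mod 4, so \<sigma>^2 and
  \<phi>^2 agree on \<open>m\<close>.\<close>

lemma (in finite_field_ext) mult_square_twist_iff:
  fixes \<sigma> :: "'a \<Rightarrow> 'a"
  assumes "galois_generator q \<sigma>" "even n"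
  shows "m * \<sigma> (\<sigma> m) = 1 \<longleftrightarrow> m ^ (q ^ 2 + 1) = 1"
proof -
  have aut: "field_aut \<sigma>" by (rule galois_generator_order[OF assms(1)])
  obtain j where j: "\<phi> = \<sigma> ^^ j" using galois_generator_order(4)[OF assms(1)] by blast
  obtain i where i: "coprime i n" "\<sigma> = \<phi> ^^ i" using galois_generator_order(5)[OF assms(1)] by blast
  then have "odd i" using assms(2) by (meson coprime_common_divisor odd_one)
  then obtain r where r: "i = 2 * r + 1" by (auto elim: oddE)
  have 4: "(\<theta> ^^ 4) m = m" if "field_aut \<theta>" "m * \<theta> (\<theta> m) = 1" for \<theta> :: "'a \<Rightarrow> 'a"
  proof -
    have "\<theta> (\<theta> m) = inverse m" using that(2) by (simp add: inverse_unique)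
    then show ?thesis by (simp add: numeral_eq_Suc field_autD[OF that(1)])
  qed
  have \<phi>2: "\<phi> (\<phi> m) = m ^ q ^ 2" using \<phi>_funpow[of 2 m] by (simp add: numeral_eq_Suc)
  have \<sigma>2: "\<sigma> (\<sigma> m) = \<phi> (\<phi> m)" if "(\<phi> ^^ 4) m = m"
  proof -
    have "\<sigma> (\<sigma> m) = (\<phi> ^^ (i + i)) m"
      by (simp only: i(2) funpow_add comp_apply)
    also have "i + i = 2 + 4 * r" by (simp add: r)
    also have "(\<phi> ^^ (2 + 4 * r)) m = (\<phi> ^^ 2) ((\<phi> ^^ (4 * r)) m)" by (simp only: funpow_add comp_apply)
    also have "\<dots> = \<phi> (\<phi> m)" using funpow_fixed[OF that] by (simp add: numeral_2_eq_2)
    finally show ?thesis .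
  qed
  have "m ^ (q ^ 2 + 1) = m * \<phi> (\<phi> m)" by (simp add: \<phi>2)
  moreover have "(\<phi> ^^ 4) m = m" if "m * \<sigma> (\<sigma> m) = 1"
    using funpow_fixed[OF 4[OF aut that], of j] by (simp add: j funpow_mult mult.commute)
  ultimately show ?thesis
    using \<sigma>2 4[OF field_aut_\<phi>] by metis
qed

section \<open>Elements fixed by the fourth power of \<sigma>\<close>

context even_cyclic_ext
begin

lemma \<sigma>_funpow_4: "(\<sigma> ^^ 4) x = \<sigma> (\<sigma> (\<sigma> (\<sigma> x)))"
  by (simp add: numeral_eq_Suc)

text \<open>Exponents may be reduced modulo 4. For odd t one has 2t = 2 mod 4, so the order
  condition itself gives the last claim.\<close>

lemma s_of_order_4:
  assumes "(\<sigma> ^^ 4) x = x"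
  shows "4 dvd t \<Longrightarrow> s x = x" "t mod 4 = 2 \<Longrightarrow> s x = \<sigma> (\<sigma> x)" "odd t \<Longrightarrow> \<sigma> (\<sigma> x) = x"
proof -
  note fixed = funpow_fixed[OF assms]
  show "s x = x" if "4 dvd t"
    using that fixed by auto
  show "s x = \<sigma> (\<sigma> x)" if "t mod 4 = 2"
  proof -
    have "t = 2 + 4 * (t div 4)" using that by presburger
    then have "s x = (\<sigma> ^^ 2) ((\<sigma> ^^ (4 * (t div 4))) x)"
      by (metis comp_apply funpow_add)
    then show ?thesis by (simp add: fixed numeral_2_eq_2)
  qed
  show "\<sigma> (\<sigma> x) = x" if "odd t"
  proof -
    have eq: "2 * t = 2 + 4 * (t div 2)" using that by presburger
    have "x = (\<sigma> ^^ (2 * t)) x" by (simp only: order id_apply)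
    also have "(\<sigma> ^^ (2 * t)) x = (\<sigma> ^^ 2) ((\<sigma> ^^ (4 * (t div 2))) x)"
      using eq by (metis comp_apply funpow_add)
    finally show ?thesis by (simp add: fixed numeral_2_eq_2)
  qed
qed

lemma eq_uminus_iff: "x = - x \<longleftrightarrow> x = (0 :: 'a)"
proof
  assume "x = - x"
  then have "2 * x = 0" by (metis add.right_inverse mult_2)
  then show "x = 0" using two by simp
qed simp

text \<open>Keeps the denominators of \<open>Psi_inverse_comp\<close> and
  \<open>Psi_twist_comp\<close> nonzero. Equality would make \<sigma>^4 fix \<open>h\<close>. For 4
  dividing t this yields h^2 = -1 and \<open>\<sigma> (\<sigma> h) = h\<close>, so the product is
  -1; for t = 2 mod 4 it makes \<open>s h\<close> both \<open>inverse h\<close> and its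
  negative.\<close>

lemma mult_square_twist_ne_1:
  assumes "even t" and h: "s h = - inverse h" "h \<noteq> 0"
  shows "h * \<sigma> (\<sigma> h) \<noteq> 1"
proof
  assume eq: "h * \<sigma> (\<sigma> h) = 1"
  then have \<sigma>2: "\<sigma> (\<sigma> h) = inverse h" by (simp add: inverse_unique)
  then have 4: "(\<sigma> ^^ 4) h = h" by (simp add: \<sigma>_funpow_4)
  have "4 dvd t \<or> t mod 4 = 2" using assms(1) by presburger
  then consider "4 dvd t" | "t mod 4 = 2" by blast
  then show False
  proof cases
    case 1
    then have "h = - inverse h" using s_of_order_4(1)[OF 4] h by simp
    then have 2: "h * h = - 1" using h(2) by (metis minus_mult_right right_inverse)
    then have "\<sigma> h * \<sigma> h = h * h"
      by (metis hom(2) hom(4) hom(5))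
    then have "\<sigma> h = h \<or> \<sigma> h = - h"
      by (simp add: square_eq_iff)
    then have "\<sigma> (\<sigma> h) = h" by auto
    then show False using 2 eq eq_uminus_iff[of 1] by simp
  next
    case 2
    then have "inverse h = - inverse h" using s_of_order_4(2)[OF 4] h \<sigma>2 by simp
    then show False using h(2) eq_uminus_iff[of "inverse h"] by simp
  qed
qed

section \<open>Codes of the other generators\<close>

lemma inv_\<tau>: "inv \<tau> = \<sigma>"
  by (rule inv_inv_eq[OF field_aut_bij[OF aut(1)]])

lemma \<tau>_funpow: "\<tau> ^^ t = s" "\<tau> ^^ (2 * t) = id"
proof -
  have "inv s = s" by (rule inv_unique_comp) (simp_all add: fun_eq_iff)
  then show "\<tau> ^^ t = s" using inv_fn[OF field_aut_bij[OF aut(1)], of t] by simp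
  show "\<tau> ^^ (2 * t) = id" using inv_fn[OF field_aut_bij[OF aut(1)], of "2 * t"] by (simp add: order)
qed

lemma funpow_pred_t: "\<sigma> ^^ (t - 1) = s \<circ> \<tau>"
proof -
  obtain r where "t = Suc r" using t by (cases t) auto
  then show ?thesis by (simp add: fun_eq_iff funpow_swap1)
qed

lemma funpow_succ_t: "\<sigma> ^^ (t + 1) = s \<circ> \<sigma>"
  by (simp add: fun_eq_iff)

lemma funpow_twist: "(\<sigma> ^^ i) ^^ (2 * t) = id"
proof -
  have "(\<sigma> ^^ i) ^^ (2 * t) = (\<sigma> ^^ (2 * t)) ^^ i" by (simp only: funpow_mult mult.commute)
  then show ?thesis by (simp add: order)
qed

text \<open>For even t both (t-1)t and (t+1)t are congruent to t modulo 2t, so these generators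
  share the involution of \<sigma>.\<close>

lemma funpow_pred_succ_t:
  assumes "even t"
  shows "(s \<circ> \<tau>) ^^ t = s" "(s \<circ> \<sigma>) ^^ t = s"
proof -
  obtain r where r: "t = 2 * r" using assms by blast
  have id: "\<sigma> ^^ (2 * t * i + t) = s" for i
  proof -
    have "\<sigma> ^^ (2 * t * i) = (\<sigma> ^^ (2 * t)) ^^ i" by (simp only: funpow_mult)
    then show ?thesis by (simp add: funpow_add order)
  qed
  have "(t - 1) * t = 2 * t * (r - 1) + t" "(t + 1) * t = 2 * t * r + t"
    using t by (simp_all add: r algebra_simps diff_mult_distrib)
  then show "(s \<circ> \<tau>) ^^ t = s" "(s \<circ> \<sigma>) ^^ t = s"
    unfolding funpow_pred_t[symmetric] funpow_succ_t[symmetric] by (simp_all only: funpow_mult id)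
qed

lemma inv_s_\<tau>: "inv (s \<circ> \<tau>) = s \<circ> \<sigma>" and inv_s_\<sigma>: "inv (s \<circ> \<sigma>) = s \<circ> \<tau>"
  by (rule inv_unique_comp; simp add: fun_eq_iff)+

lemma psi_\<sigma>: "psi h t \<sigma> = Psi \<sigma> \<tau> s h"
  using t by (intro psi_eq_Psi field_aut_bij aut_\<sigma> order) simp

lemma psi_\<tau>: "psi h t \<tau> = Psi \<tau> \<sigma> s h"
  using psi_eq_Psi[OF field_aut_bij[OF aut(2)] \<tau>_funpow(2)] t by (simp add: inv_\<tau> \<tau>_funpow)

lemma psi_s_\<tau>: "even t \<Longrightarrow> psi h t (s \<circ> \<tau>) = Psi (s \<circ> \<tau>) (s \<circ> \<sigma>) s h"
  using psi_eq_Psi[of "s \<circ> \<tau>" t h] t funpow_twist[of "t - 1", unfolded funpow_pred_t]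
    field_aut_bij[OF field_aut_comp[OF aut(3,2)]]
  by (simp add: inv_s_\<tau> funpow_pred_succ_t)

lemma psi_s_\<sigma>: "even t \<Longrightarrow> psi h t (s \<circ> \<sigma>) = Psi (s \<circ> \<sigma>) (s \<circ> \<tau>) s h"
  using psi_eq_Psi[of "s \<circ> \<sigma>" t h] t funpow_twist[of "t + 1", unfolded funpow_succ_t]
    field_aut_bij[OF field_aut_comp[OF aut(3,1)]]
  by (simp add: inv_s_\<sigma> funpow_pred_succ_t)

lemma psi_funpow_in_L: "psi h t (\<sigma> ^^ i) \<in> L"
  using t by (intro psi_in_L) (simp_all add: funpow_mult L_funpow field_aut_bij field_aut_funpow aut_\<sigma>
      funpow_twist[unfolded funpow_mult])

lemma psi_conjugate_in_L:
  "psi h t \<sigma> \<in> L" "psi h t \<tau> \<in> L" "psi h t (s \<circ> \<tau>) \<in> L" "psi h t (s \<circ> \<sigma>) \<in> L"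
proof -
  have "\<tau> = \<sigma> ^^ (2 * t - 1)" by (rule ext) (rule \<tau>_eq_funpow)
  then show "psi h t \<tau> \<in> L" using psi_funpow_in_L by metis
  show "psi h t \<sigma> \<in> L" using psi_funpow_in_L[of h 1] by simp
  show "psi h t (s \<circ> \<tau>) \<in> L" "psi h t (s \<circ> \<sigma>) \<in> L"
    unfolding funpow_pred_t[symmetric] funpow_succ_t[symmetric] by (rule psi_funpow_in_L)+
qed

text \<open>Hilbert 90 for \<open>x \<mapsto> x\<^bsup>q^2\<^esup>\<close> provides the scalar that realises the equivalence.\<close>

lemma right_equiv_unit_multiple:
  assumes m: "m * \<sigma> (\<sigma> m) = 1" "t mod 4 = 2 \<or> m = 1 \<or> m = - 1" and h: "h \<noteq> 0"
  shows "right_equiv (psi_code h t \<sigma>) (psi_code (m * h) t \<sigma>)"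
proof (cases "m = 1 \<or> m = - 1")
  case True
  then have "Psi \<sigma> \<tau> s (m * h) (1 * x) = 1 * Psi \<sigma> \<tau> s h x" for x
    using Psi_uminus[of h] by auto
  then show ?thesis
    unfolding psi_code_eq_span psi_\<sigma> by (intro right_equiv_mult[of 1 1]) auto
next
  case False
  then have t2: "t mod 4 = 2" using m(2) by blast
  define u where "u = m * \<sigma> m"
  have m0: "m \<noteq> 0" using m(1) by auto
  have "\<sigma> m * \<sigma> (\<sigma> (\<sigma> m)) = 1"
    using arg_cong[OF m(1), of \<sigma>] by simp
  then have u: "u * \<sigma> (\<sigma> u) = 1" using m(1) by (simp add: u_def algebra_simps)
  \<comment> \<open>The element \<open>1 + u\<close> solves the equation unless it is 0; for u = -1
    an element negated by \<sigma>^2 takes its place.\<close>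
  have "\<exists>y. y \<noteq> 0 \<and> u * \<sigma> (\<sigma> y) = y \<and> (\<sigma> ^^ 4) y = y"
  proof (cases "u = - 1")
    case True
    have "even t" using t2 by presburger
    then obtain g where "g \<noteq> 0" "(\<sigma> ^^ 2) g = - g"
      using exists_antifixed[of 2] by auto
    then show ?thesis
      using True by (intro exI[of _ g]) (simp add: numeral_eq_Suc)
  next
    case False
    have \<sigma>u: "\<sigma> (\<sigma> u) = inverse u" using u by (simp add: inverse_unique)
    have "u \<noteq> 0" using u by auto
    then have "u * \<sigma> (\<sigma> (1 + u)) = 1 + u" "(\<sigma> ^^ 4) (1 + u) = 1 + u"
      by (simp_all add: \<sigma>u \<sigma>_funpow_4 distrib_left add.commute)
    then show ?thesis
      using False by (metis eq_neg_iff_add_eq_0 add.commute)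
  qed
  then obtain y where y: "y \<noteq> 0" "u * \<sigma> (\<sigma> y) = y" "(\<sigma> ^^ 4) y = y" by blast
  \<comment> \<open>As \<sigma>^4 fixes \<open>y\<close>, this is the preimage of \<open>y\<close>
    under \<sigma>, and \<open>\<tau> a\<close> is \<open>\<sigma> (\<sigma> y)\<close>. The
    equation for \<open>y\<close> becomes the one that \<open>Psi_mult_unit\<close> asks of
    \<open>a\<close>.\<close>
  define a where "a = \<sigma> (\<sigma> (\<sigma> y))"
  have \<sigma>a: "\<sigma> a = y" using y(3) by (simp add: a_def \<sigma>_funpow_4)
  have "s y = \<sigma> (\<sigma> y)" by (rule s_of_order_4(2)[OF y(3) t2])
  then have sa: "s a = \<sigma> (\<sigma> a)" by (simp add: a_def flip: \<sigma>_s)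
  have "Psi \<sigma> \<tau> s (m * h) (a * x) = y * Psi \<sigma> \<tau> s h x" for x
    using Psi_mult_unit[OF m(1) sa _ h, of x] y(2) by (simp add: \<sigma>a) (simp add: a_def u_def)
  moreover have "a \<noteq> 0" using y(1) by (simp add: a_def)
  ultimately show ?thesis
    unfolding psi_code_eq_span psi_\<sigma> using y(1) by (intro right_equiv_mult[of a y])
qed

lemma right_equiv_\<tau>:
  assumes h: "s h = - inverse h" "h \<noteq> 0"
  shows "right_equiv (psi_code h t \<sigma>) (psi_code (inverse h) t \<tau>)"
proof (cases "even t")
  case True
  obtain b c where "b \<noteq> 0" "c \<noteq> 0" "\<And>x. Psi \<tau> \<sigma> s (inverse h) (b * Psi \<sigma> \<tau> s h x) = c * x"
    using Psi_inverse_comp[OF h mult_square_twist_ne_1[OF True h]] by blast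
  then show ?thesis
    unfolding psi_code_eq_span using psi_conjugate_in_L
    by (intro right_equiv_inverse[of _ _ b c]) (auto simp: psi_\<sigma> psi_\<tau>)
next
  case False
  obtain e where e: "e \<noteq> 0" "\<sigma> e = - e" using exists_antifixed[of 1] by auto
  have "(\<sigma> ^^ i) e = (- 1) ^ i * e" for i
    by (induction i) (simp_all add: e(2))
  then have "s e = - e" using False by simp
  then show ?thesis
    unfolding psi_code_eq_span psi_\<sigma> psi_\<tau> using e h(2) Psi_inverse_mult[OF h e(2)]
    by (intro right_equiv_mult[of "inverse h * e" "- (e / h)"]) auto
qed

text \<open>An element \<open>g\<close> negated by \<sigma>^2 absorbs the signs of
  \<open>Psi_twist_eq_quad\<close>. Since \<sigma>^4 fixes it, \<open>s g\<close> is
  \<open>g\<close> or \<open>- g\<close> according to t modulo 4, which decides between a multiplier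
  built from psi and a scalar one.\<close>

lemma right_equiv_s_\<tau>:
  assumes "even t" and h: "s h = - inverse h" "h \<noteq> 0"
  shows "right_equiv (psi_code h t \<sigma>) (psi_code h t (s \<circ> \<tau>))"
proof -
  obtain g where g: "g \<noteq> 0" "\<sigma> (\<sigma> g) = - g"
    using exists_antifixed[of 2] assms(1) by (auto simp: numeral_2_eq_2)
  then have 4: "(\<sigma> ^^ 4) g = g" by (simp add: \<sigma>_funpow_4)
  have "4 dvd t \<or> t mod 4 = 2" using assms(1) by presburger
  then consider "4 dvd t" | "t mod 4 = 2" by blast
  then show ?thesis
  proof cases
    case 1
    obtain b c where "b \<noteq> 0" "c \<noteq> 0"
      "\<And>x. Psi (s \<circ> \<tau>) (s \<circ> \<sigma>) s h (b * Psi \<sigma> \<tau> s h x) = c * x"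
      using Psi_twist_comp[OF h mult_square_twist_ne_1[OF assms] g(2) s_of_order_4(1)[OF 4 1] g(1)] by blast
    then show ?thesis
      unfolding psi_code_eq_span using psi_conjugate_in_L
      by (intro right_equiv_inverse[of _ _ b c]) (auto simp: psi_\<sigma> psi_s_\<tau>[OF assms(1)])
  next
    case 2
    have "s g = - g" using s_of_order_4(2)[OF 4 2] g(2) by simp
    then show ?thesis
      unfolding psi_code_eq_span psi_\<sigma> psi_s_\<tau>[OF assms(1)] using g Psi_twist_mult[OF h(1) g(2)]
      by (intro right_equiv_mult[of g "\<sigma> g"]) auto
  qed
qed

text \<open>The automorphism \<open>s \<circ> \<sigma>\<close> is the inverse of
  \<open>s \<circ> \<tau>\<close>, so the inversion argument is run for the latter as generator and
  chained with \<open>right_equiv_s_\<tau>\<close>.\<close>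

lemma right_equiv_s_\<sigma>:
  assumes "even t" and h: "s h = - inverse h" "h \<noteq> 0"
  shows "right_equiv (psi_code h t \<sigma>) (psi_code (inverse h) t (s \<circ> \<sigma>))"
proof -
  interpret twist: commuting_auts "s \<circ> \<tau>" "s \<circ> \<sigma>" s by (rule commuting_auts_twist)
  have w: "h * (s \<circ> \<tau>) ((s \<circ> \<tau>) h) \<noteq> 1"
  proof
    assume "h * (s \<circ> \<tau>) ((s \<circ> \<tau>) h) = 1"
    then have "h * \<tau> (\<tau> h) = 1" by simp
    from arg_cong[OF arg_cong[OF this, of \<sigma>], of \<sigma>] have "h * \<sigma> (\<sigma> h) = 1"
      by (simp add: mult.commute)
    then show False using mult_square_twist_ne_1[OF assms] by simp
  qed
  obtain b c where "b \<noteq> 0" "c \<noteq> 0"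
    "\<And>x. Psi (s \<circ> \<sigma>) (s \<circ> \<tau>) s (inverse h) (b * Psi (s \<circ> \<tau>) (s \<circ> \<sigma>) s h x) = c * x"
    using twist.Psi_inverse_comp[OF h w] by blast
  then have "right_equiv (psi_code h t (s \<circ> \<tau>)) (psi_code (inverse h) t (s \<circ> \<sigma>))"
    unfolding psi_code_eq_span using psi_conjugate_in_L
    by (intro right_equiv_inverse[of _ _ b c]) (auto simp: psi_s_\<sigma>[OF assms(1)] psi_s_\<tau>[OF assms(1)])
  with right_equiv_s_\<tau>[OF assms] show ?thesis by (rule right_equiv_trans)
qed

lemma right_equiv_iff:
  assumes h: "s h = - inverse h" "h \<noteq> 0" and k: "s k = - inverse k" "k \<noteq> 0"
  shows "right_equiv (psi_code h t \<sigma>) (psi_code k t \<sigma>) \<longleftrightarrow>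
    (if t mod 4 = 2 then h / k * \<sigma> (\<sigma> (h / k)) = 1 else h = k \<or> h = - k)"
proof -
  define m where "m = k / h"
  have m0: "m \<noteq> 0" using h k by (simp add: m_def)
  \<comment> \<open>The relation is stable under inversion, so k/h may replace h/k.\<close>
  have m1: "h / k * \<sigma> (\<sigma> (h / k)) = 1 \<longleftrightarrow> m * \<sigma> (\<sigma> m) = 1"
    using h(2) k(2) by (auto simp: m_def field_simps)
  have m2: "h = k \<or> h = - k \<longleftrightarrow> m = 1 \<or> m = - 1"
    using h(2) by (auto simp: m_def field_simps)
  have k': "k = m * h" using h(2) by (simp add: m_def)
  have pm: "m = 1 \<or> m = - 1" if "m * \<sigma> (\<sigma> m) = 1" "t mod 4 \<noteq> 2"
  proof -
    have 4: "(\<sigma> ^^ 4) m = m"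
    proof -
      have "\<sigma> (\<sigma> m) = inverse m" using that(1) by (simp add: inverse_unique)
      then show ?thesis by (simp add: \<sigma>_funpow_4)
    qed
    have "m * m = 1"
    proof (cases "odd t")
      case True
      then show ?thesis using s_of_order_4(3)[OF 4] that(1) by simp
    next
      case False
      then have "4 dvd t" using that(2) by presburger
      then have "s m = m" by (rule s_of_order_4(1)[OF 4])
      moreover have "s m = inverse m" using h k by (simp add: m_def divide_inverse mult.commute)
      ultimately show ?thesis using m0 by (metis right_inverse)
    qed
    then show ?thesis by (simp add: square_eq_1_iff)
  qed
  show ?thesis
  proof
    assume "right_equiv (psi_code h t \<sigma>) (psi_code k t \<sigma>)"
    then obtain f where f: "unit_L f"
      and C: "span_with_id (Psi \<sigma> \<tau> s h) = (\<lambda>g. g \<circ> f) ` span_with_id (Psi \<sigma> \<tau> s k)"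
      by (auto simp: right_equiv_def psi_code_eq_span psi_\<sigma>)
    have mem: "(\<lambda>x. 1 * x + 0 * P x) \<in> span_with_id P" "(\<lambda>x. 0 * x + 1 * P x) \<in> span_with_id P"
      for P :: "'a \<Rightarrow> 'a"
      unfolding span_with_id_def by blast+
    have "(\<lambda>x. 1 * x + 0 * Psi \<sigma> \<tau> s k x) \<circ> f \<in> span_with_id (Psi \<sigma> \<tau> s h)"
      unfolding C by (intro imageI mem)
    then obtain a b where ab: "f x = a * x + b * Psi \<sigma> \<tau> s h x" for x
      by (auto simp: mem_span_with_id)
    have "(\<lambda>x. 0 * x + 1 * Psi \<sigma> \<tau> s k x) \<circ> f \<in> span_with_id (Psi \<sigma> \<tau> s h)"
      unfolding C by (intro imageI mem)
    then obtain c d where cd: "Psi \<sigma> \<tau> s k (f x) = c * x + d * Psi \<sigma> \<tau> s h x" for x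
      by (auto simp: mem_span_with_id)
    have "a \<noteq> 0 \<or> b \<noteq> 0"
    proof (rule ccontr)
      assume "\<not> ?thesis"
      then have "f x = 0" for x by (simp add: ab)
      moreover obtain g where "g \<circ> f = id" using unit_L_inverse[OF f] by blast
      then have "g (f 0) = 0" "g (f 1) = 1" by (simp_all add: fun_eq_iff)
      ultimately show False by simp
    qed
    from Psi_equivalence_necessary[OF h k(2) this cd[unfolded ab]]
    have "m * \<sigma> (\<sigma> m) = 1"
      using h(2) by (simp add: m_def)
    then show "if t mod 4 = 2 then h / k * \<sigma> (\<sigma> (h / k)) = 1 else h = k \<or> h = - k"
      unfolding m1 m2 using pm by simp
  next
    assume "if t mod 4 = 2 then h / k * \<sigma> (\<sigma> (h / k)) = 1 else h = k \<or> h = - k"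
    then have "m * \<sigma> (\<sigma> m) = 1" "t mod 4 = 2 \<or> m = 1 \<or> m = - 1"
      unfolding m1 m2 by (auto split: if_splits)
    then show "right_equiv (psi_code h t \<sigma>) (psi_code k t \<sigma>)"
      unfolding k' by (rule right_equiv_unit_multiple[OF _ _ h(2)])
  qed
qed

text \<open>Reduces another generator \<open>f\<close> to \<sigma> by trading \<open>k\<close> for a
  parameter \<kappa>. The choice is \<open>k\<close> for \<sigma> and \<sigma>^(t-1), and
  \<open>inverse k\<close> for \<sigma>^(-1) and \<sigma>^(t+1).\<close>

lemma code_equivalent_iff_conjugate:
  assumes h: "s h = - inverse h" "h \<noteq> 0" and f: "field_aut f" "\<And>k. psi k t f \<in> L"
    and \<kappa>: "\<And>\<rho>. field_aut \<rho> \<Longrightarrow> right_equiv (psi_code (\<rho> \<kappa>) t \<sigma>) (psi_code (\<rho> k) t f)"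
    and k: "s \<kappa> = - inverse \<kappa>" "\<kappa> \<noteq> 0"
  shows "code_equivalent \<sigma> (2 * t) (psi_code h t \<sigma>) (psi_code k t f) \<longleftrightarrow>
    (\<exists>\<rho>. field_aut \<rho> \<and>
      (if t mod 4 = 2 then \<rho> h / \<kappa> * \<sigma> (\<sigma> (\<rho> h / \<kappa>)) = 1 else \<rho> h = \<kappa> \<or> \<rho> h = - \<kappa>))"
proof -
  let ?P = "\<lambda>x y. if t mod 4 = 2 then x / y * \<sigma> (\<sigma> (x / y)) = 1 else x = y \<or> x = - y"
  \<comment> \<open>Equivalence twists the second parameter, the criterion the first. Automorphisms
    preserve the condition, so the inverse of \<rho> passes between the two.\<close>
  have P: "?P h (\<rho> \<kappa>) \<longleftrightarrow> ?P (inv \<rho> h) \<kappa>" if \<rho>: "field_aut \<rho>" for \<rho> :: "'a \<Rightarrow> 'a"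
  proof -
    have "\<rho> (inv \<rho> h) = h" by (simp add: field_aut_bij[OF \<rho>] bij_is_surj surj_f_inv_f)
    then have "?P h (\<rho> \<kappa>) \<longleftrightarrow> ?P (\<rho> (inv \<rho> h)) (\<rho> \<kappa>)" by simp
    also have "\<dots> \<longleftrightarrow> ?P (inv \<rho> h) \<kappa>"
    proof -
      have "\<rho> x / \<rho> y * \<sigma> (\<sigma> (\<rho> x / \<rho> y)) = \<rho> (x / y * \<sigma> (\<sigma> (x / y)))" for x y
        by (simp add: field_autD[OF \<rho>] aut_commute[OF \<rho> aut(1)])
      moreover have "\<rho> x = - \<rho> y \<longleftrightarrow> x = - y" for x y
        by (metis field_autD(5,9)[OF \<rho>])
      moreover have "\<rho> x = 1 \<longleftrightarrow> x = 1" for x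
        by (metis field_autD(4,9)[OF \<rho>])
      ultimately show ?thesis by (simp only: field_autD(9)[OF \<rho>])
    qed
    finally show ?thesis .
  qed
  have R: "right_equiv (psi_code h t \<sigma>) (psi_code (\<rho> k) t f) \<longleftrightarrow> ?P (inv \<rho> h) \<kappa>"
    if \<rho>: "field_aut \<rho>" for \<rho>
  proof -
    have "right_equiv (psi_code h t \<sigma>) (psi_code (\<rho> k) t f) \<longleftrightarrow>
        right_equiv (psi_code h t \<sigma>) (psi_code (\<rho> \<kappa>) t \<sigma>)"
      using \<kappa>[OF \<rho>] right_equiv_trans right_equiv_sym by blast
    also have "\<dots> \<longleftrightarrow> ?P h (\<rho> \<kappa>)"
    proof (rule right_equiv_iff[OF h])
      show "s (\<rho> \<kappa>) = - inverse (\<rho> \<kappa>)" "\<rho> \<kappa> \<noteq> 0"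
        using k by (simp_all add: aut_commute[OF aut(3) \<rho>] field_autD[OF \<rho>])
    qed
    finally show ?thesis using P[OF \<rho>] by simp
  qed
  show ?thesis
    unfolding code_equivalent_iff[OF h f]
  proof
    assume "\<exists>\<rho>. field_aut \<rho> \<and> right_equiv (psi_code h t \<sigma>) (psi_code (\<rho> k) t f)"
    then obtain \<rho> where "field_aut \<rho>" "?P (inv \<rho> h) \<kappa>" using R by blast
    then show "\<exists>\<rho>. field_aut \<rho> \<and> ?P (\<rho> h) \<kappa>" using field_aut_inv by blast
  next
    assume "\<exists>\<rho>. field_aut \<rho> \<and> ?P (\<rho> h) \<kappa>"
    then obtain \<rho> where \<rho>: "field_aut \<rho>" "?P (\<rho> h) \<kappa>" by blast
    then have "right_equiv (psi_code h t \<sigma>) (psi_code (inv \<rho> k) t f)"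
      using R[OF field_aut_inv[OF \<rho>(1)], unfolded inv_inv_eq[OF field_aut_bij[OF \<rho>(1)]]] by blast
    then show "\<exists>\<rho>. field_aut \<rho> \<and> right_equiv (psi_code h t \<sigma>) (psi_code (\<rho> k) t f)"
      using field_aut_inv[OF \<rho>(1)] by blast
  qed
qed

end

theorem theorem4p6:
  fixes \<sigma> :: "'a::{field,finite} \<Rightarrow> 'a" and h k :: 'a and q n t :: nat and s :: int
  assumes "primepow q" and "odd q"
    and "n = 2 * t" and "t \<ge> 5"
    and "card (UNIV :: 'a set) = q ^ n"
    and "galois_generator q \<sigma>"
    and "rel_norm q t h = - 1" and "rel_norm q t k = - 1"
  shows "(s = 1 \<longrightarrow>
            (code_equivalent \<sigma> n (psi_code h t \<sigma>) (psi_code k t (int_funpow \<sigma> s)) \<longleftrightarrow>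
             (\<exists>\<rho>. field_aut \<rho> \<and>
                (\<not> [t = 2] (mod 4) \<longrightarrow> \<rho> h \<in> {k, - k}) \<and>
                ([t = 2] (mod 4) \<longrightarrow> (\<exists>l. \<rho> h = l * k \<and> l ^ (q ^ 2 + 1) = 1))))) \<and>
         (s = - 1 \<longrightarrow>
            (code_equivalent \<sigma> n (psi_code h t \<sigma>) (psi_code k t (int_funpow \<sigma> s)) \<longleftrightarrow>
             (\<exists>\<rho>. field_aut \<rho> \<and>
                (\<not> [t = 2] (mod 4) \<longrightarrow> \<rho> h \<in> {inverse k, - inverse k}) \<and>
                ([t = 2] (mod 4) \<longrightarrow> (\<exists>l. \<rho> h = l * inverse k \<and> l ^ (q ^ 2 + 1) = 1))))) \<and>
         (s = int t - 1 \<and> even t \<longrightarrow>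
            (code_equivalent \<sigma> n (psi_code h t \<sigma>) (psi_code k t (int_funpow \<sigma> s)) \<longleftrightarrow>
             (\<exists>\<rho>. field_aut \<rho> \<and>
                (\<not> [t = 2] (mod 4) \<longrightarrow> \<rho> h \<in> {k, - k}) \<and>
                ([t = 2] (mod 4) \<longrightarrow> (\<exists>l. \<rho> h = l * k \<and> l ^ (q ^ 2 + 1) = 1))))) \<and>
         (s = int t + 1 \<and> even t \<longrightarrow>
            (code_equivalent \<sigma> n (psi_code h t \<sigma>) (psi_code k t (int_funpow \<sigma> s)) \<longleftrightarrow>
             (\<exists>\<rho>. field_aut \<rho> \<and>
                (\<not> [t = 2] (mod 4) \<longrightarrow> \<rho> h \<in> {inverse k, - inverse k}) \<and>
                ([t = 2] (mod 4) \<longrightarrow> (\<exists>l. \<rho> h = l * inverse k \<and> l ^ (q ^ 2 + 1) = 1)))))"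
proof -
  have n: "n = 2 * t" by (fact assms(3))
  interpret K: finite_field_ext q n "TYPE('a)"
    by unfold_locales (fact assms)+
  note galois = K.galois_generator_order[OF assms(6)]
  have two: "(2 :: 'a) \<noteq> 0"
  proof
    assume "(2 :: 'a) = 0"
    then have "of_nat 2 = (0 :: 'a)" by simp
    then have "CHAR('a) dvd 2" by (simp only: of_nat_eq_0_iff_char_dvd)
    then have "CHAR('a) = 2"
      using K.prime_CHAR two_is_prime_nat by (simp only: primes_dvd_imp_eq)
    then show False using K.q_power_CHAR assms(2) by auto
  qed
  interpret even_cyclic_ext \<sigma> t
    using galois(1-3) assms(4) two K.field_aut_commute by unfold_locales (auto simp: n)
  \<comment> \<open>A generator is \<phi>^i with \<open>i\<close> coprime to the even number n,
    hence odd, so i t = t modulo n. The involution is therefore the same for every generator, and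
    the norm of x is x times its image.\<close>
  have s_power: "(\<sigma> ^^ t) x = x ^ q ^ t" for x
  proof -
    obtain i where i: "coprime i n" "\<sigma> = K.\<phi> ^^ i" using galois(5) by blast
    then have "odd i" unfolding n by (meson coprime_common_divisor dvd_triv_left odd_one)
    then obtain r where r: "i = 2 * r + 1" by (auto elim: oddE)
    have "\<sigma> ^^ t = K.\<phi> ^^ (i * t)" by (simp only: i(2) funpow_mult)
    also have "i * t = t + n * r" by (simp add: n r algebra_simps)
    also have "K.\<phi> ^^ (t + n * r) = K.\<phi> ^^ t \<circ> (K.\<phi> ^^ n) ^^ r" by (simp only: funpow_add funpow_mult)
    finally show ?thesis by (simp add: K.\<phi>_funpow K.\<phi>_order)
  qed
  have conj: "(\<sigma> ^^ t) x = - inverse x" "x \<noteq> 0" if "rel_norm q t x = - 1" for x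
  proof -
    have eq: "x * (\<sigma> ^^ t) x = - 1" using that by (simp add: rel_norm_def s_power)
    then show "x \<noteq> 0" by auto
    then show "(\<sigma> ^^ t) x = - inverse x" using eq by (simp add: field_simps)
  qed
  note h = conj[OF assms(7)] and k = conj[OF assms(8)]
  \<comment> \<open>The inverse of \<open>k\<close> again has norm -1, so it can serve as \<kappa>
    in the second and fourth case.\<close>
  have k': "(\<sigma> ^^ t) (inverse k) = - inverse (inverse k)" "inverse k \<noteq> 0" using k by simp_all
  have cond: "(if t mod 4 = 2 then x / y * \<sigma> (\<sigma> (x / y)) = 1 else x = y \<or> x = - y) \<longleftrightarrow>
      (\<not> [t = 2] (mod 4) \<longrightarrow> x \<in> {y, - y}) \<and>
      ([t = 2] (mod 4) \<longrightarrow> (\<exists>l. x = l * y \<and> l ^ (q ^ 2 + 1) = 1))" if "y \<noteq> 0" for x y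
  proof -
    have "x / y * \<sigma> (\<sigma> (x / y)) = 1 \<longleftrightarrow> (x / y) ^ (q ^ 2 + 1) = 1"
      by (rule K.mult_square_twist_iff[OF assms(6)]) (simp add: n)
    also have "\<dots> \<longleftrightarrow> (\<exists>l. x = l * y \<and> l ^ (q ^ 2 + 1) = 1)"
      using that by (metis nonzero_eq_divide_eq)
    finally show ?thesis by (simp only:) (simp add: cong_def)
  qed
  let ?E = "\<lambda>\<kappa>. \<exists>\<rho>. field_aut \<rho> \<and> (\<not> [t = 2] (mod 4) \<longrightarrow> \<rho> h \<in> {\<kappa>, - \<kappa>}) \<and>
      ([t = 2] (mod 4) \<longrightarrow> (\<exists>l. \<rho> h = l * \<kappa> \<and> l ^ (q ^ 2 + 1) = 1))"
  let ?C = "\<lambda>f. code_equivalent \<sigma> n (psi_code h t \<sigma>) (psi_code k t f)"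
  have conjugate: "(\<sigma> ^^ t) (\<rho> x) = - inverse (\<rho> x)" "\<rho> x \<noteq> 0"
    if "field_aut \<rho>" "(\<sigma> ^^ t) x = - inverse x" "x \<noteq> 0" for \<rho> x
    using that by (simp_all add: aut_commute[OF aut(3) that(1)] field_autD[OF that(1)])
  have 1: "?C \<sigma> \<longleftrightarrow> ?E k"
    unfolding n cond[OF k(2), symmetric]
  proof (rule code_equivalent_iff_conjugate[OF h aut(1) psi_conjugate_in_L(1) _ k])
    show "right_equiv (psi_code (\<rho> k) t \<sigma>) (psi_code (\<rho> k) t \<sigma>)" if "field_aut \<rho>" for \<rho>
      unfolding psi_code_eq_span by (rule right_equiv_mult[of 1 1]) simp_all
  qed
  have 2: "?C (inv \<sigma>) \<longleftrightarrow> ?E (inverse k)"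
    unfolding n cond[OF k'(2), symmetric]
  proof (rule code_equivalent_iff_conjugate[OF h aut(2) psi_conjugate_in_L(2) _ k'])
    show "right_equiv (psi_code (\<rho> (inverse k)) t \<sigma>) (psi_code (\<rho> k) t (inv \<sigma>))" if "field_aut \<rho>" for \<rho>
      using right_equiv_\<tau>[OF conjugate[OF that k']] by (simp add: field_autD[OF that])
  qed
  have 3: "?C (\<sigma> ^^ t \<circ> inv \<sigma>) \<longleftrightarrow> ?E k" if "even t"
    unfolding n cond[OF k(2), symmetric]
  proof (rule code_equivalent_iff_conjugate[OF h field_aut_comp[OF aut(3,2)] psi_conjugate_in_L(3) _ k])
    show "right_equiv (psi_code (\<rho> k) t \<sigma>) (psi_code (\<rho> k) t (\<sigma> ^^ t \<circ> inv \<sigma>))" if "field_aut \<rho>" for \<rho>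
      by (rule right_equiv_s_\<tau>[OF \<open>even t\<close> conjugate[OF that k]])
  qed
  have 4: "?C (\<sigma> ^^ t \<circ> \<sigma>) \<longleftrightarrow> ?E (inverse k)" if "even t"
    unfolding n cond[OF k'(2), symmetric]
  proof (rule code_equivalent_iff_conjugate[OF h field_aut_comp[OF aut(3,1)] psi_conjugate_in_L(4) _ k'])
    show "right_equiv (psi_code (\<rho> (inverse k)) t \<sigma>) (psi_code (\<rho> k) t (\<sigma> ^^ t \<circ> \<sigma>))" if "field_aut \<rho>" for \<rho>
      using right_equiv_s_\<sigma>[OF \<open>even t\<close> conjugate[OF that k']] by (simp add: field_autD[OF that])
  qed
  have "nat (int t - 1) = t - 1" "nat (int t + 1) = t + 1" using assms(4) by simp_all
  then have "int_funpow \<sigma> 1 = \<sigma>" "int_funpow \<sigma> (- 1) = inv \<sigma>"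
    "int_funpow \<sigma> (int t - 1) = \<sigma> ^^ t \<circ> inv \<sigma>" "int_funpow \<sigma> (int t + 1) = \<sigma> ^^ t \<circ> \<sigma>"
    using assms(4) funpow_pred_t funpow_succ_t by (simp_all add: int_funpow_def)
  then show ?thesis using 1 2 3 4 by simp
qed

end
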